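(* A pair of orientation preserving isometries $A,B$ of $\mathbb{H}^4$ is linked by half-turns if and only if $\mathcal{K}_A\cap\mathcal{K}_B\neq\emptyset$, i.e. they have a common element in their half-turn banks.
   Context: Work in $\mathbb{H}^4$ with boundary $\partial\mathbb{H}^4=\widehat{\mathbb{R}^3}$ (upper half-space model); planes (totally geodesic 2-dimensional subspaces) are identified with their boundary circles. For a plane $P$, the half-turn $H_P$ is the orientation preserving involution obtained as the composition of reflections across two orthogonal hyperplanes intersecting in $P$; its fixed point set is $P$. A pair $A,B$ is linked by half-turns if there are planes $\alpha,\beta,\delta$ with $A=H_\alpha H_\beta$ and $B=H_\beta H_\delta$. The half-turn bank $\mathcal{K}_\gamma$ of an orientation preserving isometry $\gamma$ is the following set of circles in $\widehat{\mathbb{R}^3}$: (i) If $\gamma$ is atomic (type-I elliptic, pure hyperbolic or pure parabolic), $\mathcal{K}_\gamma=\{s\cap t: s\in\mathcal{F}_\gamma,\ t\in\mathcal{T}_\gamma\}$, where: for type-I elliptic $\gamma$ with fixed (twisting) plane $P$, $\mathcal{F}_\gamma$ is the set of boundaries of hyperplanes containing $P$ and $\mathcal{T}_\gamma$ the set of boundaries of hyperplanes orthogonal to $P$; for pure hyperbolic $\gamma$ with axis $L$, $\mathcal{F}_\gamma$ is the set of boundaries of hyperplanes orthogonal to $L$ and $\mathcal{T}_\gamma$ the set of boundaries of hyperplanes containing $L$; for pure parabolic $\gamma$ conjugated to $x\mapsto x+b$ ($b\neq0$), $\mathcal{F}_\gamma$ is the set of Euclidean planes orthogonal to $b$ (with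 $\infty$) and $\mathcal{T}_\gamma$ the set of Euclidean planes parallel to $b$ (with $\infty$). (ii) If $\gamma$ is pure loxodromic or screw parabolic, write $\gamma=\tau\rho=\rho\tau$ uniquely with translation part $\tau$ (pure hyperbolic resp. pure parabolic) and rotational part $\rho$ (type-I elliptic whose fixed plane $P$, the twisting plane, is invariant under $\gamma$); then $\mathcal{K}_\gamma=\{s\cap t: s\in\mathcal{F}_\gamma,\ t\in\mathcal{R}_\gamma\}$ with $\mathcal{F}_\gamma=\mathcal{F}_\tau$ (as in (i)) and $\mathcal{R}_\gamma$ the set of boundaries of hyperplanes containing $P$. (iii) If $\gamma$ is type-II elliptic (unique fixed point) and not an involution, write $\gamma=\rho_1\rho_2$ with $\rho_1,\rho_2$ the unique commuting type-I elliptic isometries whose fixed planes meet orthogonally at the fixed point; then $\mathcal{K}_\gamma=\{s\cap t: s\in\mathcal{F}_{\rho_1},\ t\in\mathcal{F}_{\rho_2}\}$. (iv) If $\gamma$ is a type-II elliptic involution (conjugate to the antipodal map) with fixed point $x$, $\mathcal{K}_\gamma$ is the set of boundaries of all planes through $x$. (v) $\mathcal{K}_{\mathrm{id}}$ is the set of boundaries of all planes.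
   Formalization: For type-II elliptic γ that are isoclinic (equal rotation angles), the decomposition γ=ρ₁ρ₂ in (iii) is not unique; there the half-turn bank is taken as the union over all such commuting orthogonal decompositions. Elsewhere it agrees with the given definition. *)

theory Defs
  imports "HOL-Analysis.Analysis"
begin

text \<open>Hyperboloid (Lorentz) model of H^4 in R^5 = real^5.  Index 0 is the time
coordinate, indices 1..4 are space coordinates.  A k-dimensional totally geodesic
subspace of H^4 is represented by the (k+1)-dimensional timelike linear subspace
of R^5 cutting it out; its ideal boundary (null rays in it) is a round (k-1)-sphere,
so planes <-> boundary circles and hyperplanes <-> boundary spheres, and the
intersection of boundary spheres corresponds to the intersection of subspaces.\<close>

type_synonym vec5 = "real^5"
type_synonym mat5 = "real^5^5"

definition lform :: "vec5 \<Rightarrow> vec5 \<Rightarrow> real" where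
  "lform x y = x \<bullet> y - 2 * (x $ 0) * (y $ 0)"

definition hyp_pt :: "vec5 \<Rightarrow> bool" where
  "hyp_pt x \<longleftrightarrow> lform x x = -1 \<and> x $ 0 > 0"

definition opi :: "mat5 \<Rightarrow> bool" where
  "opi M \<longleftrightarrow> (\<forall>x y. lform (M *v x) (M *v y) = lform x y)
     \<and> (\<forall>x. hyp_pt x \<longrightarrow> hyp_pt (M *v x)) \<and> det M = 1"

definition lorth :: "vec5 set \<Rightarrow> vec5 set" where
  "lorth W = {v. \<forall>w\<in>W. lform v w = 0}"

definition geod :: "nat \<Rightarrow> vec5 set \<Rightarrow> bool" where
  "geod k W \<longleftrightarrow> subspace W \<and> dim W = k + 1 \<and> (\<exists>v\<in>W. lform v v < 0)"

abbreviation plane :: "vec5 set \<Rightarrow> bool" where "plane \<equiv> geod 2"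
abbreviation hyperplane :: "vec5 set \<Rightarrow> bool" where "hyperplane \<equiv> geod 3"

definition hyp_orth :: "vec5 set \<Rightarrow> vec5 set \<Rightarrow> bool" where
  "hyp_orth s W \<longleftrightarrow> (\<exists>n. lform n n > 0 \<and> n \<in> W \<and> s = lorth {n})"

definition img :: "mat5 \<Rightarrow> vec5 set \<Rightarrow> vec5 set" where
  "img g S = (\<lambda>v. g *v v) ` S"

definition fixpts :: "mat5 \<Rightarrow> vec5 set" where
  "fixpts M = {x. hyp_pt x \<and> M *v x = x}"

definition fixray :: "mat5 \<Rightarrow> vec5 \<Rightarrow> bool" where
  "fixray M v \<longleftrightarrow> v \<noteq> 0 \<and> lform v v = 0 \<and> (\<exists>c. M *v v = c *\<^sub>R v)"

definition loxodromic :: "mat5 \<Rightarrow> bool" where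
  "loxodromic M \<longleftrightarrow> opi M \<and> fixpts M = {} \<and>
     (\<exists>u v. fixray M u \<and> fixray M v \<and> v \<notin> span {u} \<and>
        (\<forall>w. fixray M w \<longrightarrow> w \<in> span {u} \<or> w \<in> span {v}))"

definition parabolic :: "mat5 \<Rightarrow> bool" where
  "parabolic M \<longleftrightarrow> opi M \<and> fixpts M = {} \<and>
     (\<exists>u. fixray M u \<and> (\<forall>w. fixray M w \<longrightarrow> w \<in> span {u}))"

definition ell1 :: "mat5 \<Rightarrow> vec5 set \<Rightarrow> bool" where
  "ell1 M P \<longleftrightarrow> opi M \<and> plane P \<and> fixpts M = {x. hyp_pt x \<and> x \<in> P}"

definition ell2 :: "mat5 \<Rightarrow> vec5 \<Rightarrow> bool" where
  "ell2 M x \<longleftrightarrow> opi M \<and> fixpts M = {x}"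

text \<open>Model pure hyperbolic: the boost along the geodesic L0 (the dilation x \<mapsto> \<lambda>x).\<close>
definition boost :: "real \<Rightarrow> mat5" where
  "boost t = (\<chi> i j. if i = j then (if i = 0 \<or> i = 4 then cosh t else 1)
                else if (i = 0 \<and> j = 4) \<or> (i = 4 \<and> j = 0) then sinh t else 0)"

definition L0 :: "vec5 set" where
  "L0 = span {axis 0 1, axis 4 1}"

definition pure_hyp :: "mat5 \<Rightarrow> bool" where
  "pure_hyp M \<longleftrightarrow> opi M \<and> (\<exists>g t. opi g \<and> t \<noteq> 0 \<and> M = g ** boost t ** matrix_inv g)"

text \<open>Model pure parabolic: the Eichler transformation fixing the null vector u0
(the point at infinity) with spatial translation vector a (the map x \<mapsto> x + b).\<close>
definition u0 :: vec5 where
  "u0 = axis 0 1 + axis 4 1"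

definition spatial :: "vec5 \<Rightarrow> bool" where
  "spatial a \<longleftrightarrow> a $ 0 = 0 \<and> a $ 4 = 0"

definition eich :: "vec5 \<Rightarrow> mat5" where
  "eich a = matrix (\<lambda>v. v - lform u0 v *\<^sub>R a
                        + (lform a v - lform a a / 2 * lform u0 v) *\<^sub>R u0)"

definition pure_par :: "mat5 \<Rightarrow> bool" where
  "pure_par M \<longleftrightarrow> opi M \<and> (\<exists>g a. opi g \<and> spatial a \<and> a \<noteq> 0 \<and> M = g ** eich a ** matrix_inv g)"

text \<open>Euclidean planes (through \<infinity>) orthogonal to b, resp. parallel to b, in the model.\<close>
definition Fpar0 :: "vec5 \<Rightarrow> vec5 set set" where
  "Fpar0 a = {lorth {a + c *\<^sub>R u0} | c. True}"

definition Tpar0 :: "vec5 \<Rightarrow> vec5 set set" where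
  "Tpar0 a = {lorth {w + c *\<^sub>R u0} | w c. spatial w \<and> w \<noteq> 0 \<and> lform w a = 0}"

definition pure_lox :: "mat5 \<Rightarrow> bool" where
  "pure_lox M \<longleftrightarrow> loxodromic M \<and> \<not> pure_hyp M"

definition screw_par :: "mat5 \<Rightarrow> bool" where
  "screw_par M \<longleftrightarrow> parabolic M \<and> \<not> pure_par M"

definition atomic :: "mat5 \<Rightarrow> bool" where
  "atomic M \<longleftrightarrow> (\<exists>P. ell1 M P) \<or> pure_hyp M \<or> pure_par M"

definition Fset :: "mat5 \<Rightarrow> vec5 set set" where
  "Fset M = {s. (\<exists>P. ell1 M P \<and> hyperplane s \<and> P \<subseteq> s)
     \<or> (pure_hyp M \<and> (\<exists>g t. opi g \<and> t \<noteq> 0 \<and> M = g ** boost t ** matrix_inv g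
            \<and> hyperplane s \<and> hyp_orth s (img g L0)))
     \<or> (pure_par M \<and> (\<exists>g a s0. opi g \<and> spatial a \<and> a \<noteq> 0 \<and> M = g ** eich a ** matrix_inv g
            \<and> s0 \<in> Fpar0 a \<and> s = img g s0))}"

definition Tset :: "mat5 \<Rightarrow> vec5 set set" where
  "Tset M = {s. (\<exists>P. ell1 M P \<and> hyperplane s \<and> hyp_orth s P)
     \<or> (pure_hyp M \<and> (\<exists>g t. opi g \<and> t \<noteq> 0 \<and> M = g ** boost t ** matrix_inv g
            \<and> hyperplane s \<and> img g L0 \<subseteq> s))
     \<or> (pure_par M \<and> (\<exists>g a s0. opi g \<and> spatial a \<and> a \<noteq> 0 \<and> M = g ** eich a ** matrix_inv g
            \<and> s0 \<in> Tpar0 a \<and> s = img g s0))}"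

definition orth_at :: "vec5 set \<Rightarrow> vec5 set \<Rightarrow> vec5 \<Rightarrow> bool" where
  "orth_at P1 P2 x \<longleftrightarrow> P1 \<inter> P2 = span {x} \<and>
     (\<forall>v\<in>P1 \<inter> lorth {x}. \<forall>w\<in>P2 \<inter> lorth {x}. lform v w = 0)"

text \<open>The half-turn bank (cases (i)--(v); the cases are mutually exclusive).\<close>
definition Kbank :: "mat5 \<Rightarrow> vec5 set set" where
  "Kbank M = {W.
      (M = mat 1 \<and> plane W)
    \<or> (atomic M \<and> (\<exists>s t. s \<in> Fset M \<and> t \<in> Tset M \<and> W = s \<inter> t))
    \<or> ((pure_lox M \<or> screw_par M) \<and>
        (\<exists>\<tau> \<rho> P s t. M = \<tau> ** \<rho> \<and> \<tau> ** \<rho> = \<rho> ** \<tau>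
           \<and> ((pure_lox M \<and> pure_hyp \<tau>) \<or> (screw_par M \<and> pure_par \<tau>))
           \<and> ell1 \<rho> P \<and> img M P = P
           \<and> s \<in> Fset \<tau> \<and> hyperplane t \<and> P \<subseteq> t \<and> W = s \<inter> t))
    \<or> (\<exists>x. ell2 M x \<and> M ** M \<noteq> mat 1 \<and>
        (\<exists>\<rho>1 \<rho>2 P1 P2 s t. M = \<rho>1 ** \<rho>2 \<and> \<rho>1 ** \<rho>2 = \<rho>2 ** \<rho>1
           \<and> ell1 \<rho>1 P1 \<and> ell1 \<rho>2 P2 \<and> orth_at P1 P2 x
           \<and> s \<in> Fset \<rho>1 \<and> t \<in> Fset \<rho>2 \<and> W = s \<inter> t))
    \<or> (\<exists>x. ell2 M x \<and> M ** M = mat 1 \<and> plane W \<and> x \<in> W)}"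

definition refl :: "vec5 \<Rightarrow> mat5" where
  "refl n = matrix (\<lambda>v. v - (2 * lform v n / lform n n) *\<^sub>R n)"

definition half_turn :: "vec5 set \<Rightarrow> mat5" where
  "half_turn P = (SOME H. \<exists>n1 n2. lform n1 n1 > 0 \<and> lform n2 n2 > 0 \<and> lform n1 n2 = 0
       \<and> lorth {n1} \<inter> lorth {n2} = P \<and> H = refl n1 ** refl n2)"

definition linked :: "mat5 \<Rightarrow> mat5 \<Rightarrow> bool" where
  "linked A B \<longleftrightarrow> (\<exists>\<alpha> \<beta> \<delta>. plane \<alpha> \<and> plane \<beta> \<and> plane \<delta>
       \<and> A = half_turn \<alpha> ** half_turn \<beta> \<and> B = half_turn \<beta> ** half_turn \<delta>)"

end

theory Submission
  imports Defs
begin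

text \<open>Since H_b H_d = H_e H_b with e = H_b d, the pair A, B is linked iff some plane W is such that both A
and B have the form H_W' H_W. So it suffices to show that the bank of an isometry M consists of exactly the
planes W with M = H_W' H_W for some plane W'.

A half-turn is a product of reflections in two orthonormal vectors normal to its plane. Choosing principal
vectors for the normal planes of W' and W, one gets W' with normals a, d and W with normals b, c such that a, b
are orthogonal to c, d. Hence M is the product of the commuting isometries r_a r_b and r_d r_c, and after
adjusting the choice either c = d or the span of c, d is positive definite. The signature of the span of a, b
decides whether r_a r_b is type-I elliptic, pure hyperbolic or pure parabolic, which gives the cases of the
bank: the normal b ranges over the spacelike vectors in the span of a, b, and c over those of the span of c, d,
or over those orthogonal to a, b when M is atomic.\<close>

text \<open>The bank is defined through arbitrary decompositions of M, not through canonical ones,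
  and this shapes both inclusions. For a screw motion, one inclusion must deduce from the mere
  commutation of the two given factors that all normals of one are orthogonal to those of the other.
  The other inclusion must recognize the type of a product of four reflections: it must find all its
  fixed points and fixed null directions, and show that it is not already pure. The quantity
  \<open>1 - (lform a b)\<^sup>2\<close>, the Gram determinant of two unit normals, governs
  everything: it is positive, zero or negative according to whether the two hyperplanes meet, touch
  at infinity or are disjoint up to the boundary. Principal vectors are wanted because they make the
  two middle reflections among the four commute, so that the product regroups into two commuting
  pairs.\<close>

section \<open>The Lorentz form and causal vectors\<close>

lemma lform_sym: "lform x y = lform y x"
  by (simp add: lform_def inner_commute)

lemma lform_add_left: "lform (x + y) z = lform x z + lform y z"
  and lform_add_right: "lform z (x + y) = lform z x + lform z y"
  and lform_diff_left: "lform (x - y) z = lform x z - lform y z"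
  and lform_diff_right: "lform z (x - y) = lform z x - lform z y"
  and lform_scaleR_left: "lform (c *\<^sub>R x) z = c * lform x z"
  and lform_scaleR_right: "lform z (c *\<^sub>R x) = c * lform z x"
  and lform_minus_left: "lform (- x) z = - lform x z"
  and lform_minus_right: "lform z (- x) = - lform z x"
  and lform_zero_left: "lform 0 z = 0"
  and lform_zero_right: "lform z 0 = 0"
  by (simp_all add: lform_def algebra_simps inner_simps)

lemmas lform_bilin = lform_add_left lform_add_right lform_diff_left lform_diff_right
  lform_scaleR_left lform_scaleR_right lform_minus_left lform_minus_right
  lform_zero_left lform_zero_right

lemma lform_axis_0: "lform v (axis 0 1) = - (v $ 0)"
  by (simp add: lform_def inner_axis)

lemma axis_component: "axis i 1 $ j = (if j = i then 1 else 0 :: real)"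
  by (simp add: axis_def)

lemma lform_axis: "i \<noteq> 0 \<Longrightarrow> lform v (axis i 1) = v $ i"
  by (simp add: lform_def inner_axis axis_component)

lemma lform_self_spatial: "v $ 0 = 0 \<Longrightarrow> lform v v = (norm v)\<^sup>2"
  by (simp add: lform_def power2_norm_eq_inner)

lemma nonspacelike_time_nonzero:
  assumes "lform x x \<le> 0" "x \<noteq> 0" shows "x $ 0 \<noteq> 0"
  using assms lform_self_spatial[of x] by auto

text \<open>Subtract the multiple of x that cancels the time coordinate: on the rest lform is the Euclidean inner product.\<close>
lemma orthogonal_nonspacelike_parallel:
  assumes "x \<noteq> 0" "lform x x \<le> 0" "lform y y \<le> 0" "lform x y = 0"
  shows "\<exists>k. y = k *\<^sub>R x"
proof -
  have x0: "x $ 0 \<noteq> 0" by (rule nonspacelike_time_nonzero) fact+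
  let ?k = "y $ 0 / x $ 0"
  define z where "z = y - ?k *\<^sub>R x"
  have "z $ 0 = 0" using x0 by (simp add: z_def)
  moreover have "lform z z \<le> 0"
  proof -
    have "lform z z = lform y y + ?k\<^sup>2 * lform x x"
      using assms(4) by (simp add: z_def lform_bilin lform_sym[of y x] power2_eq_square)
    also have "\<dots> \<le> 0" using assms(2,3) by (simp add: mult_nonneg_nonpos add_nonpos_nonpos)
    finally show ?thesis .
  qed
  ultimately have "z = 0" using lform_self_spatial[of z] by auto
  then show ?thesis by (auto simp: z_def)
qed

lemma orthogonal_timelike_spacelike:
  assumes "lform x x < 0" "lform x y = 0" "y \<noteq> 0"
  shows "lform y y > 0"
proof (rule ccontr)
  assume "\<not> ?thesis"
  moreover have "x \<noteq> 0" using assms(1) by (auto simp: lform_bilin)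
  ultimately obtain k where "y = k *\<^sub>R x"
    using orthogonal_nonspacelike_parallel[of x y] assms by (auto simp: not_less)
  then show False using assms by (auto simp: lform_bilin)
qed

text \<open>The combination of x and y that cancels the time coordinates is not timelike; expanding
  its square gives the inequality. This is the means of telling the two sheets of the hyperboloid
  apart.\<close>

lemma lform_time_sign:
  assumes "lform x x < 0" "lform y y \<le> 0" "y \<noteq> 0"
  shows "x $ 0 * y $ 0 * lform x y < 0"
proof -
  have "x \<noteq> 0" using assms(1) by (auto simp: lform_bilin)
  then have x0: "x $ 0 \<noteq> 0" using assms nonspacelike_time_nonzero[of x] by auto
  have y0: "y $ 0 \<noteq> 0" using assms nonspacelike_time_nonzero[of y] by auto
  define z where "z = x $ 0 *\<^sub>R y - y $ 0 *\<^sub>R x"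
  have "z $ 0 = 0" by (simp add: z_def)
  then have "lform z z \<ge> 0" using lform_self_spatial[of z] by auto
  moreover have "lform z z = (x$0)\<^sup>2 * lform y y + (y$0)\<^sup>2 * lform x x - 2 * (x $ 0 * y $ 0 * lform x y)"
    by (simp add: z_def lform_bilin lform_sym[of y x] power2_eq_square algebra_simps)
  moreover have "(x$0)\<^sup>2 * lform y y \<le> 0" using assms by (simp add: mult_nonneg_nonpos)
  moreover have "(y$0)\<^sup>2 * lform x x < 0" using assms y0 by (simp add: mult_pos_neg)
  ultimately show ?thesis by linarith
qed

lemma lform_nondegenerate:
  assumes h: "\<And>w. lform v w = 0" shows "v = 0"
proof -
  have "v $ i = 0" for i
    using h[of "axis i 1"] lform_axis_0[of v] lform_axis[of i v] by (cases "i = 0") auto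
  then show ?thesis by (simp add: vec_eq_iff)
qed

lemma UNIV_5: "(UNIV :: 5 set) = {0,1,2,3,4}"
proof -
  have "card {0,1,2,3,4::5} = 5" by simp
  moreover have "card (UNIV :: 5 set) = 5" by simp
  ultimately show ?thesis by (metis card_subset_eq finite subset_UNIV)
qed

subsection \<open>Lorentz isometries and reflections\<close>

text \<open>A single reflection has determinant -1 and so fails \<open>opi\<close>; this weaker
  notion keeps only the invariance of the form.\<close>

definition liso :: "mat5 \<Rightarrow> bool" where
  "liso g \<longleftrightarrow> (\<forall>x y. lform (g *v x) (g *v y) = lform x y)"

lemma lisoD: "liso g \<Longrightarrow> lform (g *v x) (g *v y) = lform x y"
  by (simp add: liso_def)

lemma opi_liso: "opi g \<Longrightarrow> liso g"
  by (simp add: opi_def liso_def)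

lemma liso_mult: "liso g \<Longrightarrow> liso h \<Longrightarrow> liso (g ** h)"
  by (simp add: liso_def matrix_vector_mul_assoc[symmetric])

lemma opi_mult: "opi g \<Longrightarrow> opi h \<Longrightarrow> opi (g ** h)"
  by (simp add: opi_def det_mul matrix_vector_mul_assoc[symmetric])

lemma liso_kernel: assumes "liso g" "g *v x = 0" shows "x = 0"
proof (rule lform_nondegenerate)
  fix w show "lform x w = 0" using lisoD[OF assms(1), of x w] assms(2) by (simp add: lform_bilin)
qed

lemma liso_inverse:
  assumes "liso g"
  shows "g ** matrix_inv g = mat 1" "matrix_inv g ** g = mat 1"
proof -
  have "inj (\<lambda>x. g *v x)"
    using liso_kernel[OF assms] by (subst linear_injective_0) auto
  then have "invertible g"
    using matrix_left_invertible_injective invertible_left_inverse by blast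
  then have "\<exists>h. g ** h = mat 1 \<and> h ** g = mat 1" by (simp add: invertible_def)
  then have "g ** matrix_inv g = mat 1 \<and> matrix_inv g ** g = mat 1"
    unfolding matrix_inv_def by (rule someI_ex)
  then show "g ** matrix_inv g = mat 1" "matrix_inv g ** g = mat 1" by auto
qed

lemma liso_inverse_mv:
  assumes "liso g"
  shows "g *v (matrix_inv g *v x) = x" "matrix_inv g *v (g *v x) = x"
  using liso_inverse[OF assms] by (simp_all add: matrix_vector_mul_assoc)

lemma liso_matrix_inv: assumes "liso g" shows "liso (matrix_inv g)"
  unfolding liso_def by (metis lisoD[OF assms] liso_inverse_mv(1)[OF assms])

lemma refl_mv: "refl n *v v = v - (2 * lform v n / lform n n) *\<^sub>R n"
proof -
  have "linear (\<lambda>v. v - (2 * lform v n / lform n n) *\<^sub>R n)"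
    by (rule linearI) (simp_all add: lform_bilin algebra_simps add_divide_distrib)
  then show ?thesis unfolding refl_def by simp
qed

lemma refl_unit: "lform n n = 1 \<Longrightarrow> refl n *v v = v - (2 * lform v n) *\<^sub>R n"
  by (simp add: refl_mv)

lemma refl_scaleR: "c \<noteq> 0 \<Longrightarrow> refl (c *\<^sub>R n) = refl n"
  by (simp add: matrix_eq refl_mv lform_bilin)

lemma refl_liso: assumes "lform n n \<noteq> 0" shows "liso (refl n)"
  unfolding liso_def
proof (intro allI)
  fix x y
  show "lform (refl n *v x) (refl n *v y) = lform x y"
    using assms by (simp add: refl_mv lform_bilin lform_sym[of n y])
qed

lemma refl_involution_mv: "lform n n \<noteq> 0 \<Longrightarrow> refl n *v (refl n *v v) = v"
  unfolding refl_mv by (simp add: lform_bilin field_simps)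

lemma refl_involution: "lform n n \<noteq> 0 \<Longrightarrow> refl n ** refl n = mat 1"
  by (simp add: matrix_eq matrix_vector_mul_assoc[symmetric] refl_involution_mv)

lemma refl_orthogonal: "lform v n = 0 \<Longrightarrow> refl n *v v = v"
  by (simp add: refl_mv)

lemma refl_self: "lform n n \<noteq> 0 \<Longrightarrow> refl n *v n = - n"
  by (simp add: refl_mv scaleR_2)

lemma refl_conj: "liso g \<Longrightarrow> refl (g *v n) *v (g *v v) = g *v (refl n *v v)"
  by (simp add: refl_mv lisoD matrix_vector_mult_diff_distrib matrix_vector_mult_scaleR)

lemma refl_commute: "lform m n = 0 \<Longrightarrow> refl m ** refl n = refl n ** refl m"
  unfolding matrix_eq matrix_vector_mul_assoc[symmetric] refl_mv
  by (simp add: lform_bilin lform_sym[of n m] algebra_simps)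

lemma refl_swap:
  assumes "lform x x = lform y y" "lform (x - y) (x - y) \<noteq> 0"
  shows "refl (x - y) *v x = y"
proof -
  have "2 * lform x (x - y) = lform (x - y) (x - y)"
    using assms(1) by (simp add: lform_bilin lform_sym[of y x])
  then show ?thesis using assms(2) by (simp add: refl_mv)
qed

text \<open>A reflection carrying n to plus or minus a coordinate vector conjugates refl n to a diagonal matrix.\<close>
lemma det_refl: assumes "lform n n > 0" shows "det (refl n) = -1"
proof -
  define m where "m = (1 / sqrt (lform n n)) *\<^sub>R n"
  have m: "lform m m = 1" using assms by (simp add: m_def lform_bilin)
  have nm: "refl n = refl m" using assms by (simp add: m_def refl_scaleR)
  define e :: vec5 where "e = axis 1 1"
  have e: "lform e e = 1" "lform (-e) (-e) = 1" by (simp_all add: e_def lform_axis axis_component lform_bilin)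
  \<comment> \<open>By the parallelogram identity the two values cannot both vanish, so one of the
    two vectors is a legitimate reflection normal.\<close>
  have "lform (m - e) (m - e) + lform (m - - e) (m - - e) = 4"
    using m e by (simp add: lform_bilin lform_sym[of e m])
  then consider "lform (m - e) (m - e) \<noteq> 0" | "lform (m - - e) (m - - e) \<noteq> 0" by linarith
  then obtain f g where f: "f = e \<or> f = - e" and g: "liso g" "g *v m = f"
    using refl_swap[of m e] refl_swap[of m "-e"] refl_liso m e by metis
  have "refl f = refl e" using f refl_scaleR[of "-1" e] by auto
  moreover have "refl f ** g = g ** refl m"
    using refl_conj[OF g(1), of m] g(2) by (simp add: matrix_eq matrix_vector_mul_assoc[symmetric])
  ultimately have "det (refl e) * det g = det g * det (refl m)" by (metis det_mul)
  moreover have "det g \<noteq> 0" using liso_inverse(1)[OF g(1)] by (metis det_I det_mul mult_zero_left zero_neq_one)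
  moreover have "det (refl e) = -1"
  proof -
    have eq: "refl e = (\<chi> i j. if i = j then (if i = 1 then -1 else 1) else 0)"
      unfolding vec_eq_iff
    proof (intro allI)
      fix i j
      have "refl e $ i $ j = (refl e *v axis j 1) $ i"
        by (simp add: matrix_vector_mul_component inner_axis)
      then show "refl e $ i $ j = (\<chi> i j. if i = j then (if i = 1 then -1 else 1) else 0) $ i $ j"
        by (auto simp: refl_mv e(1) e_def lform_axis axis_component)
    qed
    have "det (refl e) = (\<Prod>i\<in>UNIV. refl e $ i $ i)"
      by (rule det_diagonal) (simp add: eq)
    then show ?thesis by (simp add: eq)
  qed
  ultimately have "det g * det (refl m) = det g * (-1)" by simp
  then show ?thesis using nm \<open>det g \<noteq> 0\<close> by (simp only: mult_cancel_left) simp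
qed

text \<open>The pairing of x with its mirror image is at most -1, so by
  \<open>lform_time_sign\<close> the two have time coordinates of the same sign.\<close>

lemma refl_hyp_pt: assumes "lform n n > 0" "hyp_pt x" shows "hyp_pt (refl n *v x)"
proof -
  let ?y = "refl n *v x"
  have x: "lform x x = -1" "x $ 0 > 0" using assms(2) by (auto simp: hyp_pt_def)
  have y: "lform ?y ?y = -1" using lisoD[OF refl_liso, of n x x] assms x by auto
  have "lform x ?y = -1 - 2 * (lform x n)\<^sup>2 / lform n n"
    by (simp add: refl_mv lform_bilin x power2_eq_square)
  also have "\<dots> < 0" using assms(1) by (smt (verit) divide_nonneg_pos zero_le_power2)
  finally have "lform x ?y < 0" .
  moreover have "x $ 0 * ?y $ 0 * lform x ?y < 0"
    by (rule lform_time_sign) (use x y in \<open>auto simp: lform_bilin\<close>)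
  ultimately have "?y $ 0 > 0" using x(2)
    by (smt (verit) mult_nonneg_nonpos mult_nonpos_nonpos)
  then show ?thesis using y by (simp add: hyp_pt_def)
qed

lemma opi_refl_refl: "lform a a > 0 \<Longrightarrow> lform b b > 0 \<Longrightarrow> opi (refl a ** refl b)"
  using liso_mult[OF refl_liso refl_liso, of a b]
  by (simp add: opi_def liso_def det_mul det_refl refl_hyp_pt flip: matrix_vector_mul_assoc)

lemma normalize_timelike:
  assumes "lform x x < 0" obtains c where "c \<noteq> 0" "hyp_pt (c *\<^sub>R x)"
proof -
  have "x \<noteq> 0" using assms(1) by (auto simp: lform_bilin)
  then have x0: "x $ 0 \<noteq> 0" using assms nonspacelike_time_nonzero[of x] by auto
  define r where "r = sqrt (- lform x x)"
  have r: "r > 0" "lform x x = - (r * r)" using assms by (simp_all add: r_def)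
  define c where "c = sgn (x $ 0) / r"
  have "c * (c * lform x x) = -1" using r x0 by (simp add: c_def sgn_if)
  moreover have "c * x $ 0 > 0" using r x0 by (simp add: c_def sgn_if)
  moreover have "c \<noteq> 0" using r x0 by (simp add: c_def sgn_if)
  ultimately show thesis by (intro that[of c]) (simp_all add: hyp_pt_def lform_bilin)
qed

lemma normalize_spacelike:
  assumes "lform x x > 0" obtains c where "c > 0" "lform (c *\<^sub>R x) (c *\<^sub>R x) = 1"
  using assms by (intro that[of "1 / sqrt (lform x x)"]) (auto simp: lform_bilin)

subsection \<open>Lorentz orthogonal complements, planes and half-turns\<close>

lemma subspace_lorth: "subspace (lorth W)"
  by (auto simp: subspace_def lorth_def lform_bilin)

lemma lorth_span: "lorth (span W) = lorth W"
proof
  show "lorth (span W) \<subseteq> lorth W" by (auto simp: lorth_def span_base)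
  show "lorth W \<subseteq> lorth (span W)"
  proof
    fix v assume v: "v \<in> lorth W"
    have "subspace {w. lform v w = 0}" by (auto simp: subspace_def lform_bilin)
    moreover have "W \<subseteq> {w. lform v w = 0}" using v by (auto simp: lorth_def)
    ultimately have "span W \<subseteq> {w. lform v w = 0}" by (rule span_minimal[rotated])
    then show "v \<in> lorth (span W)" by (auto simp: lorth_def)
  qed
qed

lemma lorth_antimono: "V \<subseteq> W \<Longrightarrow> lorth W \<subseteq> lorth V"
  by (auto simp: lorth_def)

lemma lorth_Int: "lorth V \<inter> lorth W = lorth (V \<union> W)"
  by (auto simp: lorth_def)

lemma lorth_empty: "v \<in> lorth {}"
  by (simp add: lorth_def)

lemma lorth_insert: "v \<in> lorth (insert a W) \<longleftrightarrow> lform v a = 0 \<and> v \<in> lorth W"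
  by (simp add: lorth_def)

lemmas in_lorth = lorth_insert lorth_empty

text \<open>Flipping the time coordinate turns \<open>lform\<close> into the Euclidean inner
  product, hence carries the Lorentz complement onto the Euclidean one, where the dimension formula
  is known.\<close>

lemma dim_lorth: "dim (lorth W) + dim W = 5"
proof -
  define J :: "vec5 \<Rightarrow> vec5" where "J x = x - (2 * x $ 0) *\<^sub>R axis 0 1" for x
  have linJ: "linear J" by (rule linearI) (simp_all add: J_def algebra_simps)
  have JJ: "J (J x) = x" for x
    by (simp add: J_def axis_component algebra_simps)
  have lJ: "lform x y = J x \<bullet> y" for x y
    by (simp add: J_def lform_def inner_simps inner_axis' )
  define V where "V = {y \<in> UNIV. \<forall>x\<in>span W. orthogonal x y}"
  have "J ` lorth W = V"
  proof safe
    fix v assume "v \<in> lorth W"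
    then show "J v \<in> V" using lorth_span[of W]
      by (auto simp: V_def lorth_def orthogonal_def lJ inner_commute)
  next
    fix y assume "y \<in> V"
    then have "J y \<in> lorth W"
      by (auto simp: V_def lorth_def orthogonal_def lJ JJ span_base inner_commute)
    then show "y \<in> J ` lorth W" using JJ[of y] by force
  qed
  moreover have "dim (J ` lorth W) = dim (lorth W)"
    by (rule dim_image_eq[OF linJ]) (metis JJ inj_on_inverseI)
  moreover have "dim V + dim (span W) = dim (UNIV :: vec5 set)"
    unfolding V_def by (rule dim_subspace_orthogonal_to_vectors) auto
  ultimately show ?thesis by simp
qed

lemma lorth_lorth: "lorth (lorth W) = span W"
proof -
  have "span W \<subseteq> lorth (lorth W)"
  proof (rule span_minimal)
    show "W \<subseteq> lorth (lorth W)" by (auto simp: lorth_def lform_sym)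
  qed (rule subspace_lorth)
  moreover have "dim (lorth (lorth W)) = dim (span W)"
    using dim_lorth[of W] dim_lorth[of "lorth W"] by simp
  ultimately show ?thesis
    by (intro subspace_dim_equal[symmetric]) (auto simp: subspace_lorth)
qed

lemma lorth_lorth_subspace: "subspace W \<Longrightarrow> lorth (lorth W) = W"
  by (simp add: lorth_lorth span_eq_iff)

lemma span_pair: "x \<in> span {a, b} \<longleftrightarrow> (\<exists>s t. x = s *\<^sub>R a + t *\<^sub>R (b :: 'a :: real_vector))"
proof -
  have "x \<in> span {a, b} \<longleftrightarrow> (\<exists>s t. x - s *\<^sub>R a = t *\<^sub>R b)"
    by (auto simp: span_insert span_singleton)
  then show ?thesis by (metis add_diff_cancel_left' diff_add_cancel add.commute)
qed

lemma lorth_not_in_span: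
  assumes "n \<in> lorth S" "lform n n \<noteq> 0" shows "n \<notin> span S"
  using assms lorth_span[of S] by (force simp: lorth_def)

definition onpair :: "vec5 \<Rightarrow> vec5 \<Rightarrow> bool" where
  "onpair a b \<longleftrightarrow> lform a a = 1 \<and> lform b b = 1 \<and> lform a b = 0"

lemma onpairD:
  assumes "onpair a b"
  shows "lform a a = 1" "lform b b = 1" "lform a b = 0" "lform b a = 0"
  using assms lform_sym[of b a] by (auto simp: onpair_def)

lemma onpair_independent: assumes "onpair a b" shows "independent {a, b}" "a \<noteq> b" "dim {a, b} = 2"
proof -
  note ab = onpairD[OF assms]
  show "a \<noteq> b" using ab by auto
  have "b \<noteq> 0" using ab by (auto simp: lform_bilin)
  then have "independent {b}" by (simp add: independent_insert)
  moreover have "a \<notin> span {b}" by (rule lorth_not_in_span) (use ab in \<open>auto simp: in_lorth\<close>)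
  ultimately show ind: "independent {a, b}" by (simp add: independent_insert)
  show "dim {a, b} = 2" using dim_eq_card_independent[OF ind] \<open>a \<noteq> b\<close> by simp
qed

lemma definite_orthonormal_basis:
  assumes Q: "subspace Q" "dim Q = 2" and pos: "\<And>v. v \<in> Q \<Longrightarrow> v \<noteq> 0 \<Longrightarrow> lform v v > 0"
  obtains a b where "onpair a b" "Q = span {a, b}"
proof -
  obtain B where B: "B \<subseteq> Q" "independent B" "Q \<subseteq> span B" "card B = 2"
    using basis_exists[of Q] Q by metis
  then obtain u v where uv: "B = {u, v}" "u \<noteq> v" by (auto simp: card_2_iff)
  have "u \<noteq> 0" using B uv by (auto simp: dependent_zero)
  then obtain c where "c > 0" and a1: "lform (c *\<^sub>R u) (c *\<^sub>R u) = 1"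
    using pos[of u] B(1) uv normalize_spacelike[of u] by auto
  define a where "a = c *\<^sub>R u"
  have aQ: "a \<in> Q" using B uv Q by (auto simp: a_def subspace_scale)
  define w where "w = v - lform v a *\<^sub>R a"
  have wQ: "w \<in> Q" using B uv Q aQ by (auto simp: w_def subspace_scale subspace_diff)
  have "w \<noteq> 0"
  proof
    assume "w = 0"
    then have "v \<in> span {u}" by (auto simp: w_def a_def span_singleton)
    then show False using B(2) uv by (metis dependent_def insertI1 insert_Diff_if insert_commute singletonD Diff_insert_absorb)
  qed
  then obtain d where "d > 0" and b1: "lform (d *\<^sub>R w) (d *\<^sub>R w) = 1"
    using pos[OF wQ] normalize_spacelike[of w] by auto
  define b where "b = d *\<^sub>R w"
  have on: "onpair a b"
    using a1 b1 by (simp add: onpair_def b_def a_def[symmetric] lform_bilin)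
      (simp add: w_def lform_bilin a1[folded a_def] lform_sym[of v a])
  have "{a, b} \<subseteq> Q" using aQ wQ Q by (auto simp: b_def subspace_scale)
  moreover have "Q \<subseteq> span {a, b}"
    using card_ge_dim_independent[OF calculation onpair_independent(1)[OF on]] Q(2)
      onpair_independent(2)[OF on] by simp
  ultimately have "Q = span {a, b}" using Q(1) by (simp add: span_minimal subset_antisym)
  then show thesis using that on by blast
qed

text \<open>Projecting the time axis away from spacelike unit vectors only makes it more
  timelike.\<close>

lemma onpair_timelike_orthogonal:
  assumes "onpair a b" obtains v where "v \<in> lorth {a, b}" "lform v v < 0"
proof -
  note ab = onpairD[OF assms]
  define e :: vec5 where "e = axis 0 1"
  define v where "v = e - lform e a *\<^sub>R a - lform e b *\<^sub>R b"
  have e: "lform e e = -1" by (simp add: e_def lform_axis_0 axis_component)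
  have "v \<in> lorth {a, b}" by (simp add: v_def in_lorth lform_bilin ab)
  moreover have "lform v v = -1 - (lform e a)\<^sup>2 - (lform e b)\<^sup>2"
    by (simp add: v_def lform_bilin ab e lform_sym[of a e] lform_sym[of b e] power2_eq_square)
  then have "lform v v < 0" by (smt (verit) zero_le_power2)
  ultimately show thesis by (rule that)
qed

text \<open>The complement of a subspace that contains a timelike vector is positive definite, and
  here it has dimension 2. From now on planes are handled through their normals.\<close>

lemma plane_iff: "plane P \<longleftrightarrow> (\<exists>a b. onpair a b \<and> P = lorth {a, b})"
proof
  assume P: "plane P"
  then obtain v where v: "v \<in> P" "lform v v < 0" and subP: "subspace P" and dP: "dim P = 3"
    by (auto simp: geod_def)
  have "subspace (lorth P)" "dim (lorth P) = 2"
    using dim_lorth[of P] dP subspace_lorth by auto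
  moreover have "lform w w > 0" if "w \<in> lorth P" "w \<noteq> 0" for w
    using orthogonal_timelike_spacelike[of v w] v that by (auto simp: lorth_def lform_sym)
  ultimately obtain a b where "onpair a b" "lorth P = span {a, b}"
    by (rule definite_orthonormal_basis)
  then show "\<exists>a b. onpair a b \<and> P = lorth {a, b}"
    using lorth_lorth_subspace[OF subP] lorth_span by metis
next
  assume "\<exists>a b. onpair a b \<and> P = lorth {a, b}"
  then obtain a b where ab: "onpair a b" and P: "P = lorth {a, b}" by blast
  obtain v where "v \<in> P" "lform v v < 0" using onpair_timelike_orthogonal[OF ab] P by blast
  moreover have "dim P = 3" using dim_lorth[of "{a, b}"] onpair_independent[OF ab] P by simp
  ultimately show "plane P" by (auto simp: geod_def P subspace_lorth)
qed

lemma onpair_plane: "onpair a b \<Longrightarrow> plane (lorth {a, b})"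
  by (auto simp: plane_iff)

lemma hyperplane_iff: "hyperplane s \<longleftrightarrow> (\<exists>n. lform n n = 1 \<and> s = lorth {n})"
proof
  assume s: "hyperplane s"
  then obtain v where v: "v \<in> s" "lform v v < 0" and sub: "subspace s" and d: "dim s = 4"
    by (auto simp: geod_def)
  have "dim (lorth s) = 1" using dim_lorth[of s] d by auto
  then obtain n where n: "n \<in> lorth s" "n \<noteq> 0"
    by (metis dim_eq_0 subsetI singletonI one_neq_zero insert_iff)
  have "lform n n > 0"
    using orthogonal_timelike_spacelike[of v n] v n by (auto simp: lorth_def lform_sym)
  then obtain c where "c > 0" and c: "lform (c *\<^sub>R n) (c *\<^sub>R n) = 1" by (rule normalize_spacelike)
  have "s \<subseteq> lorth {c *\<^sub>R n}" using n by (auto simp: lorth_def lform_bilin lform_sym)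
  moreover have "dim (lorth {c *\<^sub>R n}) = 4"
    using dim_lorth[of "{c *\<^sub>R n}"] \<open>c > 0\<close> n(2) by (simp add: dim_singleton)
  ultimately have "s = lorth {c *\<^sub>R n}"
    using sub d by (intro subspace_dim_equal) (auto simp: subspace_lorth)
  then show "\<exists>n. lform n n = 1 \<and> s = lorth {n}" using c by blast
next
  assume "\<exists>n. lform n n = 1 \<and> s = lorth {n}"
  then obtain n where n: "lform n n = 1" and s: "s = lorth {n}" by blast
  have "n \<noteq> 0" using n by (auto simp: lform_bilin)
  then have "dim s = 4" using dim_lorth[of "{n}"] s by (simp add: dim_singleton)
  define e :: vec5 where "e = axis 0 1"
  define v where "v = e - lform e n *\<^sub>R n"
  have e: "lform e e = -1" by (simp add: e_def lform_axis_0 axis_component)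
  have "v \<in> s" by (simp add: s v_def in_lorth lform_bilin n)
  moreover have "lform v v = -1 - (lform e n)\<^sup>2"
    by (simp add: v_def lform_bilin n e lform_sym[of n e] power2_eq_square)
  then have "lform v v < 0" by (smt (verit) zero_le_power2)
  ultimately show "hyperplane s" using \<open>dim s = 4\<close> by (auto simp: geod_def s subspace_lorth)
qed

lemma onpair_refl_mv:
  assumes "onpair a b"
  shows "(refl a ** refl b) *v v = v - (2 * lform v a) *\<^sub>R a - (2 * lform v b) *\<^sub>R b"
  using onpairD[OF assms]
  by (simp add: refl_unit lform_bilin algebra_simps flip: matrix_vector_mul_assoc)

lemma onpair_projection:
  assumes "onpair a b"
  shows "v - lform v a *\<^sub>R a - lform v b *\<^sub>R b \<in> lorth {a, b}"
  using onpairD[OF assms] by (simp add: in_lorth lform_bilin)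

lemma onpair_expansion:
  assumes "onpair a b" "v \<in> span {a, b}"
  shows "v = lform v a *\<^sub>R a + lform v b *\<^sub>R b"
  using assms(2) onpairD[OF assms(1)] by (auto simp: span_pair lform_bilin)

text \<open>Both products subtract from v twice its projection onto the normal plane, and this
  projection does not depend on the orthonormal basis. Hence the choice made in
  \<open>half_turn\<close> is harmless.\<close>

lemma onpair_refl_cong:
  assumes ab: "onpair a b" and cd: "onpair c d" and eq: "lorth {a, b} = lorth {c, d}"
  shows "refl a ** refl b = refl c ** refl d"
  unfolding matrix_eq
proof
  fix v
  let ?p = "v - lform v a *\<^sub>R a - lform v b *\<^sub>R b"
  have p: "lform ?p c = 0" "lform ?p d = 0"
    using onpair_projection[OF ab, of v] eq by (auto simp: in_lorth)
  have span: "span {a, b} = span {c, d}"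
    using eq by (metis lorth_lorth)
  have q: "v - ?p = lform (v - ?p) c *\<^sub>R c + lform (v - ?p) d *\<^sub>R d"
    by (rule onpair_expansion[OF cd]) (simp add: span[symmetric] span_pair, blast)
  have "lform v a *\<^sub>R a + lform v b *\<^sub>R b = v - ?p" by simp
  also have "\<dots> = lform v c *\<^sub>R c + lform v d *\<^sub>R d"
    by (subst q) (simp only: lform_diff_left[of v] p diff_0_right)
  finally have "2 *\<^sub>R (lform v a *\<^sub>R a + lform v b *\<^sub>R b) = 2 *\<^sub>R (lform v c *\<^sub>R c + lform v d *\<^sub>R d)" by simp
  then show "(refl a ** refl b) *v v = (refl c ** refl d) *v v"
    unfolding onpair_refl_mv[OF ab] onpair_refl_mv[OF cd]
    by (simp add: algebra_simps)
qed

lemma half_turn_onpair: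
  assumes "onpair a b" shows "half_turn (lorth {a, b}) = refl a ** refl b"
proof -
  let ?Q = "\<lambda>H. \<exists>n1 n2. lform n1 n1 > 0 \<and> lform n2 n2 > 0 \<and> lform n1 n2 = 0
       \<and> lorth {n1} \<inter> lorth {n2} = lorth {a, b} \<and> H = refl n1 ** refl n2"
  have "?Q (refl a ** refl b)"
    using onpairD[OF assms] by (intro exI[of _ a] exI[of _ b]) (auto simp: in_lorth)
  then have "?Q (half_turn (lorth {a, b}))"
    unfolding half_turn_def by (rule someI)
  then obtain n1 n2 where n: "lform n1 n1 > 0" "lform n2 n2 > 0" "lform n1 n2 = 0"
       "lorth {n1} \<inter> lorth {n2} = lorth {a, b}" "half_turn (lorth {a, b}) = refl n1 ** refl n2"
    by blast
  obtain c d where c: "c > 0" "lform (c *\<^sub>R n1) (c *\<^sub>R n1) = 1"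
    and d: "d > 0" "lform (d *\<^sub>R n2) (d *\<^sub>R n2) = 1"
    using n normalize_spacelike by metis
  have on: "onpair (c *\<^sub>R n1) (d *\<^sub>R n2)"
    using c d n by (simp add: onpair_def) (simp add: lform_bilin)
  have "v \<in> lorth {c *\<^sub>R n1, d *\<^sub>R n2} \<longleftrightarrow> v \<in> lorth {n1} \<inter> lorth {n2}" for v
    using c(1) d(1) by (simp add: in_lorth lform_bilin)
  then have "lorth {c *\<^sub>R n1, d *\<^sub>R n2} = lorth {a, b}" using n(4) by blast
  from onpair_refl_cong[OF on assms this] show ?thesis
    using n(5) c d by (simp add: refl_scaleR)
qed

text \<open>The hypothesis says that the Gram determinant of a and b is positive, that is, that
  their span is positive definite; one Gram-Schmidt step then keeps b and replaces a.\<close>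

lemma definite_pair_orthonormal:
  assumes "lform a a = 1" "lform b b = 1" "(lform a b)\<^sup>2 < 1"
  obtains n where "onpair b n" "span {a, b} = span {b, n}" "lorth {a, b} = lorth {b, n}"
proof -
  let ?k = "lform a b"
  define w where "w = a - ?k *\<^sub>R b"
  have "lform w w = 1 - ?k\<^sup>2"
    using assms by (simp add: w_def lform_bilin lform_sym[of b a] power2_eq_square)
  then obtain c where c: "c > 0" "lform (c *\<^sub>R w) (c *\<^sub>R w) = 1"
    using normalize_spacelike[of w] assms(3) by auto
  have on: "onpair b (c *\<^sub>R w)"
    using assms c by (simp add: onpair_def) (simp add: w_def lform_bilin lform_sym[of b a])
  have "v \<in> lorth {a, b} \<longleftrightarrow> v \<in> lorth {b, c *\<^sub>R w}" for v
    using c(1) by (auto simp: in_lorth lform_bilin w_def)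
  then have "lorth {a, b} = lorth {b, c *\<^sub>R w}" by blast
  moreover from this have "span {a, b} = span {b, c *\<^sub>R w}" by (metis lorth_lorth)
  ultimately show thesis using on that by blast
qed

text \<open>Adding a large multiple of a fixed timelike vector makes any vector timelike.\<close>
lemma subset_by_hyp_pts:
  assumes V: "subspace V" and W: "subspace W" and v: "v \<in> V" "lform v v < 0"
    and sub: "\<And>x. x \<in> V \<Longrightarrow> hyp_pt x \<Longrightarrow> x \<in> W"
  shows "V \<subseteq> W"
proof
  have time: "x \<in> W" if x: "x \<in> V" "lform x x < 0" for x
  proof -
    obtain c where "c \<noteq> 0" "hyp_pt (c *\<^sub>R x)" using normalize_timelike[OF x(2)] .
    then have "c *\<^sub>R x \<in> W" using sub x V by (simp add: subspace_scale)
    then have "(1 / c) *\<^sub>R (c *\<^sub>R x) \<in> W" by (rule subspace_scale[OF W])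
    then show ?thesis using \<open>c \<noteq> 0\<close> by simp
  qed
  fix p assume p: "p \<in> V"
  define N where "N = - lform v v"
  have N: "N > 0" using v by (simp add: N_def)
  \<comment> \<open>The size of r makes \<open>k\<^sup>2 * N\<close> outweigh
    \<open>lform p p\<close>, and the sign of k makes the cross term non-positive.\<close>
  define r where "r = (\<bar>lform p p\<bar> + 1) / N + 1"
  have r: "r \<ge> 1" "r * N = \<bar>lform p p\<bar> + 1 + N" using N by (simp_all add: r_def field_simps)
  define k where "k = (if lform p v \<le> 0 then r else - r)"
  have k1: "k * lform p v \<le> 0" using r by (simp add: k_def mult_nonneg_nonpos)
  have "lform p p < k\<^sup>2 * N"
  proof -
    have "r * N \<le> r * (r * N)" using r N mult_right_mono[of 1 r "r * N"] by simp
    then have "\<bar>lform p p\<bar> + 1 + N \<le> r\<^sup>2 * N" using r(2) by (simp add: power2_eq_square mult.assoc)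
    moreover have "k\<^sup>2 * N = r\<^sup>2 * N" by (simp add: k_def)
    ultimately show ?thesis using N by linarith
  qed
  moreover have "lform (p + k *\<^sub>R v) (p + k *\<^sub>R v) = lform p p + 2 * (k * lform p v) - k\<^sup>2 * N"
    by (simp add: lform_bilin N_def lform_sym[of v p] power2_eq_square algebra_simps)
  ultimately have "lform (p + k *\<^sub>R v) (p + k *\<^sub>R v) < 0" using k1 by linarith
  then have "p + k *\<^sub>R v \<in> W" using p v V by (intro time) (auto intro: subspace_add subspace_scale)
  moreover have "k *\<^sub>R v \<in> W" using time[OF v] W by (simp add: subspace_scale)
  ultimately have "(p + k *\<^sub>R v) - k *\<^sub>R v \<in> W" using W by (blast intro: subspace_diff)
  then show "p \<in> W" by simp
qed

section \<open>Fixed vectors of elliptic isometries\<close>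

lemma subspace_fixed: "subspace {x. M *v x = (x :: vec5)}"
  by (auto simp: subspace_def matrix_vector_right_distrib matrix_vector_mult_scaleR)

text \<open>\<open>ell1\<close> prescribes the fixed points on the hyperboloid only. Both P and the
  fixed space are subspaces with a timelike vector, so \<open>subset_by_hyp_pts\<close> extends the
  equality to all vectors.\<close>

lemma ell1_fixed: assumes "ell1 M P" shows "M *v x = x \<longleftrightarrow> x \<in> P"
proof -
  have P: "plane P" and fx: "fixpts M = {x. hyp_pt x \<and> x \<in> P}"
    using assms by (auto simp: ell1_def)
  obtain v where v: "v \<in> P" "lform v v < 0" "subspace P" using P by (auto simp: geod_def)
  have 1: "P \<subseteq> {x. M *v x = x}"
    by (rule subset_by_hyp_pts[OF v(3) subspace_fixed v(1,2)]) (use fx in \<open>auto simp: fixpts_def\<close>)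
  have "{x. M *v x = x} \<subseteq> P"
    by (rule subset_by_hyp_pts[OF subspace_fixed v(3) _ v(2)]) (use 1 v(1) fx in \<open>auto simp: fixpts_def\<close>)
  with 1 show ?thesis by auto
qed

lemma ell2_fixed: assumes "ell2 M x" shows "M *v v = v \<longleftrightarrow> v \<in> span {x}"
proof -
  have fx: "fixpts M = {x}" using assms by (simp add: ell2_def)
  then have x: "hyp_pt x" "M *v x = x" by (auto simp: fixpts_def)
  have "{x} \<subseteq> {v. M *v v = v}" using x by simp
  then have 1: "span {x} \<subseteq> {v. M *v v = v}" by (rule span_minimal) (rule subspace_fixed)
  have "{v. M *v v = v} \<subseteq> span {x}"
    by (rule subset_by_hyp_pts[OF subspace_fixed subspace_span, of x])
      (use x fx in \<open>auto simp: fixpts_def hyp_pt_def intro: span_base\<close>)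
  with 1 show ?thesis by auto
qed

subsection \<open>Products of two reflections\<close>

text \<open>For unit spacelike vectors, linear independence is the condition that they are not equal up to sign.\<close>
definition upair :: "vec5 \<Rightarrow> vec5 \<Rightarrow> bool" where
  "upair a b \<longleftrightarrow> lform a a = 1 \<and> lform b b = 1 \<and> a \<noteq> b \<and> a \<noteq> - b"

lemma upairD: assumes "upair a b" shows "lform a a = 1" "lform b b = 1"
  using assms by (auto simp: upair_def)

lemma upair_sym: "upair a b \<longleftrightarrow> upair b a"
  by (auto simp: upair_def)

lemma unit_multiple:
  assumes "lform a a = 1" "lform b b = 1" "a = k *\<^sub>R b" shows "a = b \<or> a = - b"
proof -
  have "k * k = 1" using assms by (simp add: lform_bilin)
  then have "k = 1 \<or> k = -1" by (simp add: square_eq_1_iff)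
  then show ?thesis using assms(3) by auto
qed

lemma upair_coeffs:
  assumes "upair a b" "s *\<^sub>R a = t *\<^sub>R b" shows "s = 0" "t = 0"
proof -
  have "a \<noteq> 0" "b \<noteq> 0" using upairD[OF assms(1)] by (auto simp: lform_bilin)
  show "s = 0"
  proof (rule ccontr)
    assume s: "s \<noteq> 0"
    have "(1/s) *\<^sub>R (s *\<^sub>R a) = (1/s) *\<^sub>R (t *\<^sub>R b)" using assms(2) by simp
    then have "a = (t / s) *\<^sub>R b" using s by simp
    then show False using unit_multiple[of a b] assms(1) by (auto simp: upair_def)
  qed
  then show "t = 0" using assms(2) \<open>b \<noteq> 0\<close> by auto
qed

lemma refl_refl_mv:
  assumes "lform a a = 1" "lform b b = 1"
  shows "(refl a ** refl b) *v v
    = v - (2 * lform v a - 4 * lform a b * lform v b) *\<^sub>R a - (2 * lform v b) *\<^sub>R b"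
  using assms
  by (simp add: refl_unit lform_bilin lform_sym[of b a] algebra_simps flip: matrix_vector_mul_assoc)

text \<open>The displacement of v is a combination of a and b, and independence lets it vanish only
  with both coefficients. The argument is the same for every signature of the span.\<close>

lemma refl_refl_fixed:
  assumes "upair a b" shows "(refl a ** refl b) *v v = v \<longleftrightarrow> v \<in> lorth {a, b}"
proof
  note ab = upairD[OF assms]
  assume "(refl a ** refl b) *v v = v"
  then have "(2 * lform v a - 4 * lform a b * lform v b) *\<^sub>R a = (- 2 * lform v b) *\<^sub>R b"
    unfolding refl_refl_mv[OF ab] by (simp add: algebra_simps add_eq_0_iff)
  from upair_coeffs[OF assms this] show "v \<in> lorth {a, b}" by (auto simp: in_lorth)
next
  assume "v \<in> lorth {a, b}"
  then show "(refl a ** refl b) *v v = v"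
    using refl_refl_mv[OF upairD[OF assms]] by (simp add: in_lorth)
qed

lemma upair_if_not_id:
  assumes "lform a a = 1" "lform b b = 1" "refl a ** refl b \<noteq> mat 1"
  shows "upair a b"
  using assms refl_involution[of b] refl_scaleR[of "-1" b] by (auto simp: upair_def)

lemma upair_definite_plane:
  assumes "upair a b" "(lform a b)\<^sup>2 < 1" shows "plane (lorth {a, b})"
  using definite_pair_orthonormal[of a b] upairD[OF assms(1)] assms(2) onpair_plane by metis

lemma ell1_refl_refl:
  assumes "upair a b" "(lform a b)\<^sup>2 < 1" shows "ell1 (refl a ** refl b) (lorth {a, b})"
  using upair_definite_plane[OF assms] refl_refl_fixed[OF assms(1)] upairD[OF assms(1)]
    opi_refl_refl[of a b]
  by (auto simp: ell1_def fixpts_def)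

text \<open>The vector a' is the Clifford product a b y.\<close>
lemma three_reflections:
  assumes "lform a a = 1" "lform b b = 1" and y: "y = x *\<^sub>R a + z *\<^sub>R b" "lform y y \<noteq> 0"
  defines "a' \<equiv> (2 * lform a b * x + z) *\<^sub>R a - x *\<^sub>R b"
  shows "lform a' a' = lform y y" "refl a ** refl b = refl a' ** refl y"
proof -
  define k where "k = lform a b"
  define q where "q = x * x + 2 * k * x * z + z * z"
  have k: "lform a b = k" "lform b a = k" by (simp_all add: k_def lform_sym)
  have yy: "lform y y = q"
    by (simp add: y(1) lform_bilin assms(1,2) k q_def algebra_simps)
  show aa: "lform a' a' = lform y y"
    unfolding yy by (simp add: a'_def lform_bilin assms(1,2) k q_def algebra_simps)
  have ya: "lform y a' = k * q"
    by (simp add: y(1) a'_def lform_bilin assms(1,2) k q_def algebra_simps)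
  have q: "q \<noteq> 0" using y yy by simp
  show "refl a ** refl b = refl a' ** refl y"
    unfolding matrix_eq
  proof
    fix v
    define A where "A = lform v a"
    define B where "B = lform v b"
    have vy: "lform v y = x * A + z * B"
      by (simp add: y(1) lform_bilin A_def B_def)
    have va: "lform v a' = (2 * k * x + z) * A - x * B"
      by (simp add: a'_def lform_bilin A_def B_def k)
    have c: "lform (refl y *v v) a' = z * A - x * B - 2 * k * z * B"
      using q by (simp add: refl_mv lform_bilin yy vy va ya field_simps)
    have "(refl a' ** refl y) *v v = v - ((2 / q) * (x * A + z * B)) *\<^sub>R y
        - ((2 / q) * (z * A - x * B - 2 * k * z * B)) *\<^sub>R a'"
      unfolding matrix_vector_mul_assoc[symmetric] refl_mv[of a'] c aa yy
      by (simp add: refl_mv yy vy)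
    also have "\<dots> = v - ((2 / q) * ((x * A + z * B) * x + (z * A - x * B - 2 * k * z * B) * (2 * k * x + z))) *\<^sub>R a
       - ((2 / q) * ((x * A + z * B) * z - (z * A - x * B - 2 * k * z * B) * x)) *\<^sub>R b"
      by (simp add: y(1) a'_def k algebra_simps)
    also have "(2 / q) * ((x * A + z * B) * x + (z * A - x * B - 2 * k * z * B) * (2 * k * x + z))
        = (2 / q) * (q * (A - 2 * k * B))"
      by (rule arg_cong[where f = "\<lambda>u. 2 / q * u"]) (simp add: q_def algebra_simps)
    also have "(2 / q) * ((x * A + z * B) * z - (z * A - x * B - 2 * k * z * B) * x) = (2 / q) * (q * B)"
      by (rule arg_cong[where f = "\<lambda>u. 2 / q * u"]) (simp add: q_def algebra_simps)
    finally show "(refl a ** refl b) *v v = (refl a' ** refl y) *v v"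
      using q by (simp add: refl_refl_mv assms(1,2) k A_def B_def)
  qed
qed

lemma sum_5: "sum f (UNIV :: 5 set) = f 0 + f 1 + f 2 + f 3 + f 4"
  unfolding UNIV_5 by (simp add: add.assoc)

subsection \<open>The model transformations\<close>

lemma boost_mv:
  "boost t *v v = v + ((cosh t - 1) * v $ 0 + sinh t * v $ 4) *\<^sub>R axis 0 1
     + (sinh t * v $ 0 + (cosh t - 1) * v $ 4) *\<^sub>R axis 4 1"
  unfolding vec_eq_iff
proof
  fix i :: 5
  have "i = 0 \<or> i = 1 \<or> i = 2 \<or> i = 3 \<or> i = 4" using UNIV_5 by blast
  then show "(boost t *v v) $ i = (v + ((cosh t - 1) * v $ 0 + sinh t * v $ 4) *\<^sub>R axis 0 1
     + (sinh t * v $ 0 + (cosh t - 1) * v $ 4) *\<^sub>R axis 4 1) $ i"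
    by (elim disjE) (simp_all add: matrix_vector_mult_def boost_def sum_5 axis_component algebra_simps)
qed

text \<open>The vector \<open>a\<close> is y moved by \<open>boost (t/2)\<close>: a translation is
  the product of two reflections whose mirrors are half its length apart. As y is an arbitrary
  non-null vector of the span of the two axes, the second mirror can be prescribed.\<close>

lemma boost_refl:
  fixes t :: real
  defines "ch \<equiv> cosh (t/2)" and "sh \<equiv> sinh (t/2)"
  assumes y: "y = x *\<^sub>R axis 0 1 + z *\<^sub>R axis 4 1" "lform y y \<noteq> 0"
  defines "a \<equiv> (ch * x + sh * z) *\<^sub>R axis 0 1 + (sh * x + ch * z) *\<^sub>R axis 4 1"
  shows "lform a a = lform y y" "boost t = refl a ** refl y"
proof -
  define e0 e4 :: vec5 where "e0 = axis 0 1" and "e4 = axis 4 1"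
  have e: "lform v e0 = - v $ 0" "lform v e4 = v $ 4" for v
    by (simp_all add: e0_def e4_def lform_axis_0 lform_axis)
  have ee: "e0 $ 0 = 1" "e0 $ 4 = 0" "e4 $ 0 = 0" "e4 $ 4 = 1"
    by (simp_all add: e0_def e4_def axis_component)
  have y': "y = x *\<^sub>R e0 + z *\<^sub>R e4" by (simp add: y e0_def e4_def)
  have a': "a = (ch * x + sh * z) *\<^sub>R e0 + (sh * x + ch * z) *\<^sub>R e4" by (simp add: a_def e0_def e4_def)
  have h: "ch * ch = 1 + sh * sh"
    using hyperbolic_pythagoras[of "t/2"] by (simp add: ch_def sh_def power2_eq_square)
  have ct: "cosh t = 1 + 2 * (sh * sh)" "sinh t = 2 * (sh * ch)"
    using cosh_double[of "t/2"] sinh_double[of "t/2"] h by (simp_all add: ch_def sh_def power2_eq_square)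
  define q where "q = z * z - x * x"
  have yy: "lform y y = q"
    by (simp add: y' lform_bilin e ee q_def algebra_simps)
  have q: "q \<noteq> 0" using y yy by simp
  show aa: "lform a a = lform y y"
    unfolding yy by (simp add: a' lform_bilin e ee) (use h in \<open>simp add: q_def; algebra\<close>)
  have ya: "lform y a = ch * q"
    by (simp add: y' a' lform_bilin e ee q_def algebra_simps)
  show "boost t = refl a ** refl y"
    unfolding matrix_eq
  proof
    fix v :: vec5
    define A where "A = v $ 0"
    define B where "B = v $ 4"
    have vy: "lform v y = z * B - x * A"
      by (simp add: y' lform_bilin A_def B_def e)
    have va: "lform v a = (sh * x + ch * z) * B - (ch * x + sh * z) * A"
      by (simp add: a' lform_bilin A_def B_def e)
    define w where "w = (sh * x + ch * z) * B - (ch * x + sh * z) * A - 2 * ch * (z * B - x * A)"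
    have c: "lform (refl y *v v) a = w"
      using q by (simp add: refl_mv lform_bilin yy vy va ya w_def field_simps)
    have "(refl a ** refl y) *v v = v - ((2 / q) * (z * B - x * A)) *\<^sub>R y - ((2 / q) * w) *\<^sub>R a"
      unfolding matrix_vector_mul_assoc[symmetric] refl_mv[of a] c aa yy
      by (simp add: refl_mv yy vy)
    also have "\<dots> = v - ((2 / q) * ((z * B - x * A) * x + w * (ch * x + sh * z))) *\<^sub>R e0
       - ((2 / q) * ((z * B - x * A) * z + w * (sh * x + ch * z))) *\<^sub>R e4"
      by (simp add: y' a' algebra_simps)
    also have "(z * B - x * A) * x + w * (ch * x + sh * z) = q * (- (sh * sh) * A - sh * ch * B)"
      using h unfolding w_def q_def by algebra
    also have "(z * B - x * A) * z + w * (sh * x + ch * z) = q * (- sh * ch * A - (sh * sh) * B)"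
      using h unfolding w_def q_def by algebra
    finally show "boost t *v v = (refl a ** refl y) *v v"
      using q by (simp add: boost_mv ct A_def B_def e0_def e4_def algebra_simps)
  qed
qed

lemma lform_u0: "lform u0 u0 = 0" "u0 \<noteq> 0" "spatial a \<Longrightarrow> lform a u0 = 0" "spatial a \<Longrightarrow> lform u0 a = 0"
proof -
  have e: "lform v u0 = v $ 4 - v $ 0" for v
    by (simp add: u0_def lform_bilin lform_axis_0 lform_axis)
  show "lform u0 u0 = 0" by (simp add: e) (simp add: u0_def axis_component)
  have "u0 $ 0 = 1" by (simp add: u0_def axis_component)
  then show "u0 \<noteq> 0" by auto
  show "lform a u0 = 0" "lform u0 a = 0" if "spatial a" 
    using that lform_sym[of u0 a] by (auto simp: e spatial_def)
qed

lemma spatial_positive: "spatial a \<Longrightarrow> a \<noteq> 0 \<Longrightarrow> lform a a > 0"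
  by (simp add: spatial_def lform_self_spatial)

lemma eich_mv: "eich a *v v = v - lform u0 v *\<^sub>R a + (lform a v - lform a a / 2 * lform u0 v) *\<^sub>R u0"
proof -
  have "linear (\<lambda>v. v - lform u0 v *\<^sub>R a + (lform a v - lform a a / 2 * lform u0 v) *\<^sub>R u0)"
    by (rule linearI) (simp_all add: lform_bilin algebra_simps add_divide_distrib)
  then show ?thesis unfolding eich_def by simp
qed

text \<open>The vector \<open>a + c *\<^sub>R u0\<close> is normal to a Euclidean plane orthogonal
  to a, with c recording its position. Since \<open>eich a\<close> raises c by
  \<open>lform a a\<close>, two mirrors whose positions differ by half of that compose to the
  translation.\<close>

lemma eich_refl:
  assumes a: "spatial a" "a \<noteq> 0"
  shows "eich a = refl (a + (c + lform a a / 2) *\<^sub>R u0) ** refl (a + c *\<^sub>R u0)"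
  unfolding matrix_eq
proof
  fix v
  define q where "q = lform a a"
  have q: "q > 0" using spatial_positive a by (simp add: q_def)
  define A where "A = lform v a"
  define U where "U = lform v u0"
  have sy: "lform a v = A" "lform u0 v = U" by (simp_all add: A_def U_def lform_sym)
  let ?b = "a + c *\<^sub>R u0" and ?d = "a + (c + q / 2) *\<^sub>R u0"
  have n: "lform ?b ?b = q" "lform ?d ?d = q" "lform ?b ?d = q"
    by (simp_all add: lform_bilin lform_u0 a q_def)
  have vb: "lform v ?b = A + c * U" "lform v ?d = A + (c + q/2) * U"
    by (simp_all add: lform_bilin A_def U_def)
  have "lform (refl ?b *v v) ?d = - A - (c - q / 2) * U"
    using q by (simp only: refl_mv[of ?b] lform_diff_left lform_scaleR_left n vb) (simp add: field_simps)
  then have "(refl ?d ** refl ?b) *v v = v - (2 * (A + c * U) / q) *\<^sub>R ?b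
     - (2 * (- A - (c - q / 2) * U) / q) *\<^sub>R ?d"
    unfolding matrix_vector_mul_assoc[symmetric] refl_mv[of ?d] n by (simp add: refl_mv[of ?b] n vb)
  also have "\<dots> = v - ((2 * (A + c * U) + 2 * (- A - (c - q / 2) * U)) / q) *\<^sub>R a
     - ((2 * (A + c * U) * c + 2 * (- A - (c - q / 2) * U) * (c + q/2)) / q) *\<^sub>R u0"
    by (simp add: algebra_simps add_divide_distrib diff_divide_distrib)
  also have "(2 * (A + c * U) + 2 * (- A - (c - q / 2) * U)) / q = U"
    using q by (simp add: field_simps)
  also have "(2 * (A + c * U) * c + 2 * (- A - (c - q / 2) * U) * (c + q/2)) / q = q / 2 * U - A"
    using q by (simp add: field_simps)
  finally show "eich a *v v = (refl (a + (c + lform a a / 2) *\<^sub>R u0) ** refl ?b) *v v"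
    by (simp add: eich_mv sy flip: q_def) (simp add: algebra_simps)
qed

section \<open>Conjugates of the models and their fixed vectors\<close>

lemma refl_refl_conj:
  assumes "liso g"
  shows "g ** (refl a ** refl b) ** matrix_inv g = refl (g *v a) ** refl (g *v b)"
  unfolding matrix_eq
proof
  fix v
  show "(g ** (refl a ** refl b) ** matrix_inv g) *v v = (refl (g *v a) ** refl (g *v b)) *v v"
    using refl_conj[OF assms, of b "matrix_inv g *v v"] refl_conj[OF assms, of a "refl b *v (matrix_inv g *v v)"]
    by (simp add: liso_inverse_mv(1)[OF assms] flip: matrix_vector_mul_assoc)
qed

lemma conj_fixed:
  assumes "liso g"
  shows "(g ** B ** matrix_inv g) *v x = x \<longleftrightarrow> B *v (matrix_inv g *v x) = matrix_inv g *v x"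
  using liso_inverse_mv[OF assms] by (metis matrix_vector_mul_assoc)

lemma img_lorth: assumes "liso g" shows "img g (lorth S) = lorth ((\<lambda>v. g *v v) ` S)"
proof safe
  fix x assume "x \<in> img g (lorth S)"
  then show "x \<in> lorth ((\<lambda>v. g *v v) ` S)" by (auto simp: img_def lorth_def lisoD[OF assms])
next
  fix x assume x: "x \<in> lorth ((\<lambda>v. g *v v) ` S)"
  have "matrix_inv g *v x \<in> lorth S"
    using x by (auto simp: lorth_def) (metis lisoD[OF assms] liso_inverse_mv(1)[OF assms])
  then show "x \<in> img g (lorth S)"
    unfolding img_def by (metis image_eqI liso_inverse_mv(1)[OF assms])
qed

text \<open>In the model, the equations for the coordinates 0 and 4 of a fixed vector have
  determinant \<open>2 - 2 * cosh t\<close>, which is not zero. So the time coordinate vanishes and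
  the vector is spacelike.\<close>

lemma pure_hyp_fixed:
  assumes "pure_hyp M" "M *v x = x" "x \<noteq> 0" shows "lform x x > 0"
proof -
  obtain g t where g: "liso g" "t \<noteq> 0" "M = g ** boost t ** matrix_inv g"
    using assms(1) opi_liso by (auto simp: pure_hyp_def)
  define y where "y = matrix_inv g *v x"
  have "boost t *v y = y" using assms(2) conj_fixed[OF g(1)] by (simp add: g(3) y_def)
  then have eq: "((cosh t - 1) * y $ 0 + sinh t * y $ 4) *\<^sub>R axis 0 1
     + (sinh t * y $ 0 + (cosh t - 1) * y $ 4) *\<^sub>R axis 4 1 = (0 :: vec5)"
    by (simp add: boost_mv)
  have e: "(cosh t - 1) * y $ 0 + sinh t * y $ 4 = 0" "sinh t * y $ 0 + (cosh t - 1) * y $ 4 = 0"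
    using arg_cong[OF eq, of "\<lambda>v. v $ 0"] arg_cong[OF eq, of "\<lambda>v. v $ 4"]
    by (simp_all add: axis_component)
  have h: "cosh t ^ 2 - sinh t ^ 2 = 1" by (rule hyperbolic_pythagoras)
  have "2 * (cosh t - 1) * y $ 0 = 0" using e h by algebra
  moreover have "cosh t \<noteq> 1" using g(2) by (simp add: cosh_real_one_iff)
  ultimately have "y $ 0 = 0" by simp
  moreover have "y \<noteq> 0" using assms(3) liso_inverse_mv(1)[OF g(1), of x] by (auto simp: y_def)
  ultimately have "lform y y > 0" by (simp add: lform_self_spatial)
  then show ?thesis using lisoD[OF liso_matrix_inv[OF g(1)]] by (simp add: y_def)
qed

text \<open>In the model, fixed vectors are orthogonal to the null vector \<open>u0\<close>, which
  is impossible for timelike ones. The bound is not strict because \<open>u0\<close> itself is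
  fixed.\<close>

lemma pure_par_fixed:
  assumes "pure_par M" "M *v x = x" shows "lform x x \<ge> 0"
proof (rule ccontr)
  assume x: "\<not> ?thesis"
  obtain g a where g: "liso g" and a: "spatial a" "a \<noteq> 0" and M: "M = g ** eich a ** matrix_inv g"
    using assms(1) opi_liso by (auto simp: pure_par_def)
  define y where "y = matrix_inv g *v x"
  have y: "lform y y < 0" using lisoD[OF liso_matrix_inv[OF g(1)]] x by (simp add: y_def)
  have "eich a *v y = y" using assms(2) conj_fixed[OF g(1)] by (simp add: M y_def)
  then have eq: "lform u0 y *\<^sub>R a = (lform a y - lform a a / 2 * lform u0 y) *\<^sub>R u0"
    by (simp add: eich_mv algebra_simps)
  have "lform (lform u0 y *\<^sub>R a) a = 0"
    unfolding eq by (simp add: lform_bilin lform_u0 a)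
  then have "lform u0 y = 0" using spatial_positive[OF a] by (simp add: lform_bilin)
  then show False using orthogonal_timelike_spacelike[of y u0] y lform_u0 by (auto simp: lform_sym)
qed

text \<open>With \<open>upair_if_not_id\<close>, this makes the two normals in any factorization of
  an atomic isometry into reflections independent.\<close>

lemma atomic_not_id: assumes "atomic M" shows "M \<noteq> mat 1"
proof
  define e :: vec5 where "e = axis 0 1"
  have e: "lform e e = -1" by (simp add: e_def lform_axis_0 axis_component)
  assume M: "M = mat 1"
  consider P where "ell1 M P" | "pure_hyp M" | "pure_par M" using assms by (auto simp: atomic_def)
  then show False
  proof cases
    case 1
    have "dim P = 3" using 1 by (simp add: ell1_def geod_def)
    moreover have "P = UNIV" using ell1_fixed[OF 1] M by auto
    ultimately show False by simp
  next
    case 2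
    have "e \<noteq> 0" using e by (auto simp: lform_bilin)
    then show False using pure_hyp_fixed[OF 2, of e] M e by auto
  next
    case 3
    then show False using pure_par_fixed[OF 3, of e] M e by auto
  qed
qed

lemma opi_lform: "opi M \<Longrightarrow> lform (M *v x) (M *v y) = lform x y"
  by (simp add: opi_def)

section \<open>Atomic isometries as products of two reflections\<close>

text \<open>N preserves the complement of the fixed hyperplane, which is the line of n. There it can
  only send n to n or to its negative, and the former would make N the identity.\<close>

lemma refl_eqI:
  assumes N: "liso N" "N \<noteq> mat 1" and n: "lform n n = 1"
    and fx: "\<And>x. x \<in> lorth {n} \<Longrightarrow> N *v x = x"
  shows "N = refl n"
proof -
  have dec: "x - lform x n *\<^sub>R n \<in> lorth {n}" for x
    using n by (simp add: in_lorth lform_bilin)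
  have Nn: "N *v n = lform (N *v n) n *\<^sub>R n"
  proof -
    define d where "d = N *v n - lform (N *v n) n *\<^sub>R n"
    have "lform d w = 0" for w
    proof -
      define p where "p = w - lform w n *\<^sub>R n"
      have p: "p \<in> lorth {n}" unfolding p_def by (rule dec)
      then have "lform (N *v n) (N *v p) = 0" by (simp add: lisoD[OF N(1)] in_lorth lform_sym[of n p])
      then have "lform (N *v n) p = 0" using fx[OF p] by simp
      then have "lform d p = 0" using p by (simp add: d_def lform_bilin in_lorth lform_sym[of n p])
      moreover have "lform d n = 0" using n by (simp add: d_def lform_bilin)
      moreover have "w = p + lform w n *\<^sub>R n" by (simp add: p_def)
      ultimately show ?thesis by (metis lform_add_right lform_scaleR_right add_0 mult_zero_right)
    qed
    then have "d = 0" by (rule lform_nondegenerate)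
    then show ?thesis by (simp add: d_def)
  qed
  have "lform (N *v n) (N *v n) = 1" using n by (simp add: lisoD[OF N(1)])
  then have "N *v n = n \<or> N *v n = - n" using unit_multiple[OF _ n Nn] by simp
  moreover have Nx: "N *v x = x - lform x n *\<^sub>R n + lform x n *\<^sub>R (N *v n)" for x
  proof -
    have "N *v x = N *v ((x - lform x n *\<^sub>R n) + lform x n *\<^sub>R n)" by simp
    also have "\<dots> = N *v (x - lform x n *\<^sub>R n) + lform x n *\<^sub>R (N *v n)"
      by (simp only: matrix_vector_right_distrib matrix_vector_mult_scaleR)
    finally show ?thesis using fx[OF dec] by simp
  qed
  moreover have "N *v n \<noteq> n"
  proof
    assume "N *v n = n"
    then have "N *v x = x" for x using Nx[of x] by simp
    then have "N = mat 1" by (simp add: matrix_eq)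
    then show False using N by simp
  qed
  ultimately have Nn: "N *v n = - n" by blast
  show ?thesis unfolding matrix_eq
  proof
    fix x
    have "(2 * lform x n) *\<^sub>R n = lform x n *\<^sub>R n + lform x n *\<^sub>R n"
      by (simp only: mult_2 scaleR_add_left)
    then show "N *v x = refl n *v x"
      unfolding Nx[of x] Nn refl_unit[OF n] by (simp only: scaleR_minus_right diff_diff_eq add_uminus_conv_diff)
  qed
qed

text \<open>The vector m is n turned by a right angle within the positive definite plane.\<close>

lemma onpair_completion:
  assumes "onpair a b" "n \<in> span {a, b}" "lform n n = 1"
  obtains m where "onpair m n" "lorth {m, n} = lorth {a, b}"
proof -
  note ab = onpairD[OF assms(1)]
  obtain s t where n: "n = s *\<^sub>R a + t *\<^sub>R b" using assms(2) by (auto simp: span_pair)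
  have st: "s * s + t * t = 1" using assms(3) by (simp add: n lform_bilin ab)
  define m where "m = (- t) *\<^sub>R a + s *\<^sub>R b"
  have on: "onpair m n" using st by (simp add: onpair_def m_def n lform_bilin ab algebra_simps)
  have "v \<in> lorth {m, n} \<longleftrightarrow> v \<in> lorth {a, b}" for v
  proof -
    have "lform v a = s * lform v n - t * lform v m" "lform v b = t * lform v n + s * lform v m"
      using st by (simp_all add: m_def n lform_bilin) algebra+
    then show ?thesis by (auto simp: in_lorth) (simp_all add: m_def n lform_bilin)
  qed
  then show thesis using on that by blast
qed

text \<open>With m in lorth P orthogonal to n and d = M m - m, the isometry refl d M fixes m and P, hence the
  hyperplane orthogonal to n, and its determinant is -1; so it is refl n.\<close>
lemma ell1_refl_decomposition:
  assumes M: "ell1 M P" and n: "lform n n = 1" "n \<in> lorth P"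
  obtains a where "lform a a = 1" "M = refl a ** refl n"
proof -
  have opi: "opi M" using M by (simp add: ell1_def)
  obtain p q where pq: "onpair p q" and P: "P = lorth {p, q}" using M by (auto simp: ell1_def plane_iff)
  have "n \<in> span {p, q}" using n(2) by (simp add: P lorth_lorth)
  then obtain m where mn: "onpair m n" and P': "P = lorth {m, n}"
    using onpair_completion[OF pq _ n(1)] P by metis
  note m = onpairD[OF mn]
  obtain v where v: "v \<in> P" "lform v v < 0" using onpair_timelike_orthogonal[OF mn] P' by auto
  define d where "d = M *v m - m"
  have Mv: "M *v v = v" using ell1_fixed[OF M] v by simp
  have "m \<notin> P" using m by (auto simp: P' in_lorth)
  then have "d \<noteq> 0" using ell1_fixed[OF M, of m] by (auto simp: d_def)
  have dP: "lform x d = 0" if "x \<in> P" for x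
  proof -
    have "lform x (M *v m) = lform (M *v x) (M *v m)" using ell1_fixed[OF M, of x] that by simp
    also have "\<dots> = lform x m" using opi by (rule opi_lform)
    finally show ?thesis by (simp add: d_def lform_bilin)
  qed
  have dd: "lform d d > 0"
    using orthogonal_timelike_spacelike[OF v(2) dP[OF v(1)] \<open>d \<noteq> 0\<close>] .
  define N where "N = refl d ** M"
  have N: "liso N" unfolding N_def using dd opi_liso[OF opi] by (intro liso_mult refl_liso) auto
  have "det N = -1" using dd opi by (simp add: N_def det_mul det_refl opi_def)
  then have "N \<noteq> mat 1" by auto
  moreover have Nm: "N *v m = m"
    using refl_swap[of "M *v m" m] opi_lform[OF opi, of m m] dd
    by (simp add: N_def d_def flip: matrix_vector_mul_assoc)
  have NP: "N *v x = x" if "x \<in> P" for x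
    using ell1_fixed[OF M, of x] that dP[OF that]
    by (simp add: N_def refl_orthogonal flip: matrix_vector_mul_assoc)
  have "N *v x = x" if "x \<in> lorth {n}" for x
  proof -
    have "x - lform x m *\<^sub>R m \<in> P" using that m by (simp add: P' in_lorth lform_bilin)
    then have "N *v (x - lform x m *\<^sub>R m) = x - lform x m *\<^sub>R m" by (rule NP)
    then show ?thesis by (simp add: matrix_vector_mult_diff_distrib matrix_vector_mult_scaleR Nm)
  qed
  ultimately have "N = refl n" using refl_eqI N n by blast
  moreover have "M = refl d ** N"
    using refl_involution[of d] dd by (simp add: N_def matrix_mul_assoc)
  moreover obtain c where "c > 0" "lform (c *\<^sub>R d) (c *\<^sub>R d) = 1"
    using normalize_spacelike[OF dd] .
  ultimately show thesis using that[of "c *\<^sub>R d"] by (simp add: refl_scaleR)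
qed

text \<open>This puts the three atomic kinds on one footing: with s prescribed as the second mirror,
  \<open>ell1_refl_decomposition\<close>, \<open>boost_refl\<close> or \<open>eich_refl\<close>
  supplies the first one. The equal lengths of the two normals allow a common rescaling.\<close>

lemma Fset_elim:
  assumes "s \<in> Fset M"
  obtains a b where "lform a a = 1" "lform b b = 1" "s = lorth {b}" "M = refl a ** refl b"
proof -
  note thesisI = that
  have normalized: thesis
    if h: "lform y y > 0" "lform x x = lform y y" "s = lorth {y}" "M = refl x ** refl y" for x y
  proof -
    obtain c where c: "c > 0" "lform (c *\<^sub>R y) (c *\<^sub>R y) = 1" using normalize_spacelike[OF h(1)] .
    have "v \<in> lorth {c *\<^sub>R y} \<longleftrightarrow> v \<in> lorth {y}" for v using c(1) by (simp add: in_lorth lform_bilin)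
    then have "s = lorth {c *\<^sub>R y}" using h(3) by blast
    moreover have "lform (c *\<^sub>R x) (c *\<^sub>R x) = 1" using c(2) h(2) by (simp add: lform_bilin)
    ultimately show thesis using thesisI[of "c *\<^sub>R x" "c *\<^sub>R y"] c h(4) by (simp add: refl_scaleR)
  qed
  consider (ell) P where "ell1 M P" "hyperplane s" "P \<subseteq> s"
    | (hyp) g t where "opi g" "M = g ** boost t ** matrix_inv g" "hyp_orth s (img g L0)"
    | (par) g a s0 where "opi g" "spatial a" "a \<noteq> 0" "M = g ** eich a ** matrix_inv g"
        "s0 \<in> Fpar0 a" "s = img g s0"
    using assms unfolding Fset_def by blast
  then show thesis
  proof cases
    case ell
    obtain n where n: "lform n n = 1" "s = lorth {n}" using ell(2) by (auto simp: hyperplane_iff)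
    then have "n \<in> lorth P" using ell(3) lorth_antimono[OF ell(3)] by (auto simp: lorth_def lform_sym)
    then show thesis using ell1_refl_decomposition[OF ell(1) n(1)] that n by metis
  next
    case hyp
    note g = opi_liso[OF hyp(1)]
    obtain n where n: "lform n n > 0" "n \<in> img g L0" "s = lorth {n}" using hyp(3) by (auto simp: hyp_orth_def)
    then obtain y where y: "n = g *v y" "y \<in> span {axis 0 1, axis 4 1}" by (auto simp: img_def L0_def)
    then obtain x z where xz: "y = x *\<^sub>R axis 0 1 + z *\<^sub>R axis 4 1" by (auto simp: span_pair)
    have "lform y y > 0" using n y by (simp add: lisoD[OF g])
    then obtain a where "lform a a = lform y y" "boost t = refl a ** refl y"
      using boost_refl[OF xz] by auto
    then have "M = refl (g *v a) ** refl n" "lform (g *v a) (g *v a) = lform n n"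
      using refl_refl_conj[OF g] by (simp_all add: hyp(2) y lisoD[OF g])
    then show thesis using normalized n by blast
  next
    case par
    note g = opi_liso[OF par(1)]
    obtain c where c: "s0 = lorth {a + c *\<^sub>R u0}" using par(5) by (auto simp: Fpar0_def)
    let ?y = "a + c *\<^sub>R u0" and ?x = "a + (c + lform a a / 2) *\<^sub>R u0"
    have n: "lform ?y ?y = lform a a" "lform ?x ?x = lform a a"
      by (simp_all add: lform_bilin lform_u0 par(2))
    have "M = refl (g *v ?x) ** refl (g *v ?y)"
      using eich_refl[OF par(2,3), of c] refl_refl_conj[OF g] by (simp add: par(4))
    moreover have "s = lorth {g *v ?y}" using img_lorth[OF g, of "{?y}"] par(6) c by simp
    ultimately show thesis
      using normalized[of "g *v ?y" "g *v ?x"] n spatial_positive[OF par(2,3)] by (simp add: lisoD[OF g])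
  qed
qed

text \<open>All that is wanted of \<open>Tset M\<close> is a normal fixed by M: when M is a
  nontrivial product of two reflections, such a normal is orthogonal to both of their
  normals.\<close>

lemma Tset_elim:
  assumes "t \<in> Tset M"
  obtains c where "lform c c = 1" "t = lorth {c}" "M *v c = c"
proof -
  note thesisI = that
  have normalized: thesis
    if h: "lform y y > 0" "t = lorth {y}" "M *v y = y" for y
  proof -
    obtain c where c: "c > 0" "lform (c *\<^sub>R y) (c *\<^sub>R y) = 1" using normalize_spacelike[OF h(1)] .
    have "v \<in> lorth {c *\<^sub>R y} \<longleftrightarrow> v \<in> lorth {y}" for v using c(1) by (simp add: in_lorth lform_bilin)
    then have "t = lorth {c *\<^sub>R y}" using h(2) by blast
    then show thesis using thesisI[of "c *\<^sub>R y"] c h(3) by (simp add: matrix_vector_mult_scaleR)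
  qed
  consider (ell) P where "ell1 M P" "hyp_orth t P"
    | (hyp) g r where "opi g" "M = g ** boost r ** matrix_inv g" "hyperplane t" "img g L0 \<subseteq> t"
    | (par) g a s0 where "opi g" "spatial a" "a \<noteq> 0" "M = g ** eich a ** matrix_inv g"
        "s0 \<in> Tpar0 a" "t = img g s0"
    using assms unfolding Tset_def by blast
  then show thesis
  proof cases
    case ell
    then show thesis using normalized ell1_fixed[OF ell(1)] by (auto simp: hyp_orth_def)
  next
    case hyp
    note g = opi_liso[OF hyp(1)]
    obtain n where n: "lform n n = 1" "t = lorth {n}" using hyp(3) by (auto simp: hyperplane_iff)
    define y where "y = matrix_inv g *v n"
    have gy: "g *v y = n" by (simp add: y_def liso_inverse_mv[OF g])
    have "g *v axis 0 1 \<in> t" "g *v axis 4 1 \<in> t"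
      using hyp(4) by (auto simp: img_def L0_def intro: span_base)
    then have "lform y (axis 0 1) = 0" "lform y (axis 4 1) = 0"
      unfolding n(2) gy[symmetric] by (auto simp: in_lorth lisoD[OF g] lform_sym)
    then have "boost r *v y = y" by (simp add: boost_mv lform_axis_0 lform_axis)
    then have "M *v n = n" using conj_fixed[OF g, of "boost r" n] by (simp add: hyp(2) y_def)
    then show thesis using n that by blast
  next
    case par
    note g = opi_liso[OF par(1)]
    obtain w c where w: "spatial w" "w \<noteq> 0" "lform w a = 0" and c: "s0 = lorth {w + c *\<^sub>R u0}"
      using par(5) by (auto simp: Tpar0_def)
    let ?y = "w + c *\<^sub>R u0"
    have "eich a *v ?y = ?y"
      by (simp add: eich_mv lform_bilin lform_u0 par(2) w lform_sym[of a w])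
    then have "M *v (g *v ?y) = g *v ?y"
      using conj_fixed[OF g, of "eich a" "g *v ?y"] by (simp only: par(4) liso_inverse_mv[OF g])
    moreover have "t = lorth {g *v ?y}" using img_lorth[OF g, of "{?y}"] par(6) c by simp
    moreover have "lform (g *v ?y) (g *v ?y) > 0"
      using spatial_positive[OF w(1,2)] by (simp add: lisoD[OF g] lform_bilin lform_u0 w)
    ultimately show thesis using normalized by blast
  qed
qed

subsection \<open>Lorentz frames and normal forms\<close>

definition oriso :: "mat5 \<Rightarrow> bool" where
  "oriso g \<longleftrightarrow> liso g \<and> (\<forall>x. hyp_pt x \<longrightarrow> hyp_pt (g *v x)) \<and> (det g = 1 \<or> det g = -1)"

lemma oriso_id: "oriso (mat 1)"
  by (simp add: oriso_def liso_def)

lemma oriso_refl: "lform n n > 0 \<Longrightarrow> oriso (refl n)"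
  by (simp add: oriso_def refl_liso refl_hyp_pt det_refl)

lemma oriso_mult: "oriso g \<Longrightarrow> oriso h \<Longrightarrow> oriso (g ** h)"
  by (auto simp: oriso_def liso_mult det_mul simp flip: matrix_vector_mul_assoc)

lemma oriso_extend:
  assumes g: "oriso g" "g *v h = f" and h: "lform h h = lform e e"
    and pos: "e \<noteq> h \<Longrightarrow> lform (e - h) (e - h) > 0"
  obtains g' where "oriso g'" "g' *v e = f"
    "\<And>s. lform s e = 0 \<Longrightarrow> lform (g *v s) f = 0 \<Longrightarrow> g' *v s = g *v s"
proof (cases "e = h")
  case True
  then show thesis using g that by blast
next
  case False
  note p = pos[OF False]
  have "refl (e - h) *v e = h" using p h by (intro refl_swap) auto
  moreover have "refl (e - h) *v s = s" if "lform s e = 0" "lform (g *v s) f = 0" for s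
  proof -
    have "lform s h = 0" using that g lisoD[of g s h] by (simp add: oriso_def)
    then show ?thesis using that by (intro refl_orthogonal) (simp add: lform_bilin)
  qed
  ultimately show thesis
    using that[of "g ** refl (e - h)"] oriso_mult[OF g(1) oriso_refl[OF p]] g(2)
    by (simp flip: matrix_vector_mul_assoc)
qed

text \<open>The sum of two points of the hyperboloid is timelike and orthogonal to their
  difference.\<close>

lemma hyp_pt_diff_spacelike:
  assumes "hyp_pt x" "hyp_pt y" "x \<noteq> y" shows "lform (x - y) (x - y) > 0"
proof (rule orthogonal_timelike_spacelike[of "x + y"])
  have x: "lform x x = -1" "lform y y = -1" "x $ 0 > 0" "y $ 0 > 0"
    using assms by (auto simp: hyp_pt_def)
  have "y \<noteq> 0" using x by auto
  then have "x $ 0 * y $ 0 * lform x y < 0" using lform_time_sign[of x y] x by auto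
  then have "lform x y < 0" using x by (simp add: mult_less_0_iff)
  then show "lform (x + y) (x + y) < 0" using x by (simp add: lform_bilin lform_sym[of y x])
  show "lform (x + y) (x - y) = 0" using x by (simp add: lform_bilin lform_sym[of y x])
qed (use assms in auto)

lemma lform_axis_axis: "lform (axis 0 1) (axis 0 1) = -1" "i \<noteq> 0 \<Longrightarrow> lform (axis i 1) (axis i 1) = 1"
  "i \<noteq> j \<Longrightarrow> lform (axis i 1) (axis j 1) = 0"
  by (auto simp add: lform_def inner_axis axis_component)

lemma oriso_frame2:
  assumes f: "hyp_pt f0" "lform f4 f4 = 1" "lform f4 f0 = 0"
  obtains g where "oriso g" "g *v axis 0 1 = f0" "g *v axis 4 1 = f4"
proof -
  have e0: "hyp_pt (axis 0 1)" by (simp add: hyp_pt_def lform_axis_axis axis_component)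
  obtain g where g: "oriso g" "g *v axis 0 1 = f0"
    using oriso_extend[OF oriso_id, of f0 f0 "axis 0 1"] hyp_pt_diff_spacelike[OF e0 f(1)] f(1) e0
    by (auto simp: hyp_pt_def)
  have l: "liso g" using g by (simp add: oriso_def)
  define h where "h = matrix_inv g *v f4"
  have h: "g *v h = f4" by (simp add: h_def liso_inverse_mv[OF l])
  have hh: "lform h h = lform (axis 4 1) (axis 4 1)" using lisoD[OF l, of h h] h f by (simp add: lform_axis_axis)
  have "lform (axis 0 1) h = 0" using lisoD[OF l, of h "axis 0 1"] h g f by (simp add: lform_sym)
  then have "lform (axis 0 1) (axis 4 1 - h) = 0" by (simp add: lform_bilin lform_axis_axis)
  then have "axis 4 1 \<noteq> h \<Longrightarrow> lform (axis 4 1 - h) (axis 4 1 - h) > 0"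
    using orthogonal_timelike_spacelike[of "axis 0 1" "axis 4 1 - h"] by (simp add: lform_axis_axis)
  then obtain g' where g': "oriso g'" "g' *v axis 4 1 = f4"
    "\<And>s. lform s (axis 4 1) = 0 \<Longrightarrow> lform (g *v s) f4 = 0 \<Longrightarrow> g' *v s = g *v s"
    using oriso_extend[OF g(1) h hh] by blast
  have "g' *v axis 0 1 = f0" using g'(3)[of "axis 0 1"] f g by (simp add: lform_axis_axis lform_sym[of f0 f4])
  then show thesis using that g' by blast
qed

text \<open>The frames in use involve only the axes 0, 1 and 4, so a reflection in the spare axis 2
  corrects the determinant without moving them.\<close>

lemma opi_of_oriso:
  assumes "oriso g" obtains g' where "opi g'" "\<And>s. lform s (axis 2 1) = 0 \<Longrightarrow> g' *v s = g *v s"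
proof (cases "det g = 1")
  case True
  then show thesis using assms that[of g] by (simp add: oriso_def opi_def liso_def)
next
  case False
  then have "det g = -1" using assms by (simp add: oriso_def)
  then have "det (g ** refl (axis 2 1)) = 1" by (simp add: det_mul det_refl lform_axis_axis)
  moreover have "oriso (g ** refl (axis 2 1))"
    by (intro oriso_mult assms oriso_refl) (simp add: lform_axis_axis)
  ultimately have "opi (g ** refl (axis 2 1))" by (simp add: oriso_def opi_def liso_def)
  then show thesis by (rule that) (simp add: refl_orthogonal flip: matrix_vector_mul_assoc)
qed

lemma opi_frame2:
  assumes f: "hyp_pt f0" "lform f4 f4 = 1" "lform f4 f0 = 0"
  obtains g where "opi g" "g *v axis 0 1 = f0" "g *v axis 4 1 = f4"
proof -
  obtain g where g: "oriso g" "g *v axis 0 1 = f0" "g *v axis 4 1 = f4" using oriso_frame2[OF f] .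
  obtain g' where "opi g'" "\<And>s. lform s (axis 2 1) = 0 \<Longrightarrow> g' *v s = g *v s" using opi_of_oriso[OF g(1)] by blast
  then show thesis using that[of g'] g by (simp add: lform_axis_axis)
qed

lemma opi_frame3:
  assumes f: "hyp_pt f0" "lform f4 f4 = 1" "lform f4 f0 = 0"
    and b: "lform b b = 1" "lform b f0 = 0" "lform b f4 = 0"
  obtains g where "opi g" "g *v axis 0 1 = f0" "g *v axis 4 1 = f4" "g *v axis 1 1 = b"
proof -
  obtain g where g: "oriso g" "g *v axis 0 1 = f0" "g *v axis 4 1 = f4" using oriso_frame2[OF f] .
  have l: "liso g" using g by (simp add: oriso_def)
  define h where "h = matrix_inv g *v b"
  have h: "g *v h = b" by (simp add: h_def liso_inverse_mv[OF l])
  have hh: "lform h h = lform (axis 1 1) (axis 1 1)" using lisoD[OF l, of h h] h b by (simp add: lform_axis_axis)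
  have "lform (axis 0 1) h = 0" using lisoD[OF l, of h "axis 0 1"] h g b by (simp add: lform_sym)
  then have "lform (axis 0 1) (axis 1 1 - h) = 0" by (simp add: lform_bilin lform_axis_axis)
  then have "axis 1 1 \<noteq> h \<Longrightarrow> lform (axis 1 1 - h) (axis 1 1 - h) > 0"
    using orthogonal_timelike_spacelike[of "axis 0 1" "axis 1 1 - h"] by (simp add: lform_axis_axis)
  then obtain g' where g': "oriso g'" "g' *v axis 1 1 = b"
    "\<And>s. lform s (axis 1 1) = 0 \<Longrightarrow> lform (g *v s) b = 0 \<Longrightarrow> g' *v s = g *v s"
    using oriso_extend[OF g(1) h hh] by blast
  have "g' *v axis 0 1 = f0" using g'(3)[of "axis 0 1"] b g by (simp add: lform_axis_axis lform_sym[of f0 b])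
  moreover have "g' *v axis 4 1 = f4" using g'(3)[of "axis 4 1"] b g by (simp add: lform_axis_axis lform_sym[of f4 b])
  moreover obtain g'' where "opi g''" "\<And>s. lform s (axis 2 1) = 0 \<Longrightarrow> g'' *v s = g' *v s"
    using opi_of_oriso[OF g'(1)] by blast
  ultimately show thesis using that[of g''] g'(2) by (simp add: lform_axis_axis)
qed

text \<open>The component w of a orthogonal to b is timelike. Normalized, it takes the place of the
  time axis, and b that of axis 4; in this frame both normals lie in the plane of the boost.\<close>

lemma hyperbolic_normal_form:
  assumes "upair a b" "(lform a b)\<^sup>2 > 1"
  obtains g t where "opi g" "t \<noteq> 0" "refl a ** refl b = g ** boost t ** matrix_inv g"
    "b \<in> img g L0" "img g L0 \<subseteq> span {a, b}"
proof -
  note ab = upairD[OF assms(1)]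
  define k where "k = lform a b"
  have k: "k\<^sup>2 > 1" using assms by (simp add: k_def)
  define w where "w = a - k *\<^sub>R b"
  have ww: "lform w w = 1 - k\<^sup>2"
    using ab by (simp add: w_def lform_bilin lform_sym[of b a] power2_eq_square flip: k_def)
  have wb: "lform w b = 0" using ab by (simp add: w_def lform_bilin flip: k_def)
  obtain c where c: "c \<noteq> 0" "hyp_pt (c *\<^sub>R w)" using normalize_timelike[of w] ww k by auto
  obtain g where g: "opi g" "g *v axis 0 1 = c *\<^sub>R w" "g *v axis 4 1 = b"
    using opi_frame2[OF c(2) ab(2)] wb by (auto simp: lform_bilin lform_sym)
  note l = opi_liso[OF g(1)]
  have cc: "c\<^sup>2 * (k\<^sup>2 - 1) = 1" using c(2) by (simp add: hyp_pt_def lform_bilin ww power2_eq_square algebra_simps)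
  \<comment> \<open>A hyperbolic cosine is positive while k may be negative; replacing a by its
    multiple by the sign of k does not change the reflection.\<close>
  define \<sigma> where "\<sigma> = sgn k"
  have \<sigma>: "\<sigma> * \<sigma> = 1" "\<sigma> * k = \<bar>k\<bar>" "\<sigma> \<noteq> 0" using k by (auto simp: \<sigma>_def sgn_if)
  \<comment> \<open>Since \<open>a = w + k *\<^sub>R b\<close>, its coordinates in the frame are
    \<open>1 / c\<close> and k; up to the sign they must be the hyperbolic sine and cosine of s. The
    boost moves by twice this distance.\<close>
  define s where "s = arsinh (\<sigma> / c)"
  have sh: "sinh s = \<sigma> / c" by (simp add: s_def)
  have "(cosh s)\<^sup>2 = 1 + (1/c)\<^sup>2"
    using hyperbolic_pythagoras[of s] \<sigma> by (simp add: sh power_divide power2_eq_square)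
  also have "\<dots> = k\<^sup>2" using cc c(1) by (simp add: power2_eq_square field_simps)
  finally have ch: "cosh s = \<bar>k\<bar>" using cosh_real_pos[of s] by (metis abs_of_pos power2_eq_iff abs_of_neg abs_if abs_minus_cancel)
  have "g *v (sinh s *\<^sub>R axis 0 1 + cosh s *\<^sub>R axis 4 1) = \<sigma> *\<^sub>R a"
  proof -
    have "g *v (sinh s *\<^sub>R axis 0 1 + cosh s *\<^sub>R axis 4 1) = (\<sigma> / c) *\<^sub>R (c *\<^sub>R w) + (\<sigma> * k) *\<^sub>R b"
      by (simp only: matrix_vector_right_distrib matrix_vector_mult_scaleR g sh ch \<sigma>)
    also have "\<dots> = \<sigma> *\<^sub>R (w + k *\<^sub>R b)" using c by (simp add: algebra_simps)
    finally show ?thesis by (simp add: w_def)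
  qed
  moreover have "boost (2 * s) = refl (sinh s *\<^sub>R axis 0 1 + cosh s *\<^sub>R axis 4 1) ** refl (axis 4 1)"
    using boost_refl(2)[of "axis 4 1" 0 1 "2 * s"] by (simp add: lform_axis_axis)
  ultimately have "g ** boost (2 * s) ** matrix_inv g = refl (\<sigma> *\<^sub>R a) ** refl b"
    using refl_refl_conj[OF l] g(3) by simp
  then have "refl a ** refl b = g ** boost (2 * s) ** matrix_inv g" using \<sigma> by (simp add: refl_scaleR)
  moreover have "2 * s \<noteq> 0" using sh \<sigma> c by auto
  moreover have "b \<in> img g L0"
    using g(3) by (auto simp: img_def L0_def intro!: image_eqI[of _ _ "axis 4 1"] span_base)
  moreover have "img g L0 \<subseteq> span {a, b}"
  proof
    fix x assume "x \<in> img g L0"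
    then obtain p q where "x = g *v (p *\<^sub>R axis 0 1 + q *\<^sub>R axis 4 1)"
      by (auto simp: img_def L0_def span_pair)
    then have "x = p *\<^sub>R (c *\<^sub>R w) + q *\<^sub>R b"
      by (simp only: matrix_vector_right_distrib matrix_vector_mult_scaleR g)
    then have "x = (p * c) *\<^sub>R a + (q - p * c * k) *\<^sub>R b" by (simp add: w_def algebra_simps)
    then show "x \<in> span {a, b}" by (auto simp: span_pair)
  qed
  ultimately show thesis using that g(1) by blast
qed

lemma spatial_axis_1: "spatial (r *\<^sub>R axis 1 1)"
  by (simp add: spatial_def axis_component)

text \<open>Here the component u of a orthogonal to b is null and becomes, up to scale, the image of
  the point at infinity \<open>u0\<close>; the vector b gives the direction of translation.\<close>

lemma parabolic_normal_form:
  assumes "upair a b" "(lform a b)\<^sup>2 = 1"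
  obtains g r where "opi g" "r \<noteq> 0" "refl a ** refl b = g ** eich (r *\<^sub>R axis 1 1) ** matrix_inv g"
    "g *v axis 1 1 = b" "g *v u0 \<in> span {a, b}"
proof -
  note ab = upairD[OF assms(1)]
  define k where "k = lform a b"
  have k: "k * k = 1" using assms by (simp add: k_def power2_eq_square)
  define u where "u = a - k *\<^sub>R b"
  have uu: "lform u u = 0"
    using ab k by (simp add: u_def lform_bilin lform_sym[of b a] flip: k_def)
  have ub: "lform u b = 0" using ab by (simp add: u_def lform_bilin flip: k_def)
  have u: "u \<noteq> 0" using upair_coeffs(1)[OF assms(1), of 1 k] by (auto simp: u_def)
  have "hyperplane (lorth {b})" using ab by (auto simp: hyperplane_iff)
  then obtain v where v: "lform v b = 0" "lform v v < 0" by (auto simp: geod_def in_lorth)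
  obtain d where d: "d \<noteq> 0" "hyp_pt (d *\<^sub>R v)" using normalize_timelike[OF v(2)] .
  define f0 where "f0 = d *\<^sub>R v"
  have f0: "hyp_pt f0" "lform f0 f0 = -1" "lform b f0 = 0"
    using d v by (simp_all add: f0_def hyp_pt_def lform_bilin lform_sym)
  define m where "m = - lform u f0"
  have m: "m \<noteq> 0" "lform u f0 = - m" "lform f0 u = - m"
    using orthogonal_timelike_spacelike[of f0 u] u uu f0 by (auto simp: m_def lform_sym)
  \<comment> \<open>Chosen to make \<open>f0 + f4\<close>, the image of \<open>u0\<close>, a
    multiple of u; the factor \<open>1 / m\<close> makes f4 a unit vector orthogonal to f0.\<close>
  define f4 where "f4 = (1 / m) *\<^sub>R u - f0"
  have f4: "lform f4 f4 = 1" "lform f4 f0 = 0" "lform b f4 = 0"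
    using m f0 uu ub by (simp_all add: f4_def lform_bilin lform_sym[of b u])
  obtain g where g: "opi g" "g *v axis 0 1 = f0" "g *v axis 4 1 = f4" "g *v axis 1 1 = b"
    using opi_frame3[OF f0(1) f4(1,2) ab(2) f0(3) f4(3)] .
  note l = opi_liso[OF g(1)]
  have gu: "g *v u0 = (1 / m) *\<^sub>R u"
    by (simp add: u0_def matrix_vector_right_distrib g f4_def)
  \<comment> \<open>This value gives \<open>r * r / 2 / m = r * k\<close>, so the first mirror of
    the model gets the normal \<open>r *\<^sub>R b + (r * k) *\<^sub>R u\<close>, which is a
    multiple of a because \<open>k * k = 1\<close>.\<close>
  define r where "r = 2 * k * m"
  have r: "r \<noteq> 0" using k m by (auto simp: r_def)
  have rr: "lform (r *\<^sub>R axis 1 1) (r *\<^sub>R axis 1 1) = r * r" by (simp add: lform_bilin lform_axis_axis)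
  have "eich (r *\<^sub>R axis 1 1) = refl (r *\<^sub>R axis 1 1 + (r * r / 2) *\<^sub>R u0) ** refl (r *\<^sub>R axis 1 1)"
    using eich_refl[OF spatial_axis_1, of r 0] r rr by simp
  then have "g ** eich (r *\<^sub>R axis 1 1) ** matrix_inv g
      = refl (g *v (r *\<^sub>R axis 1 1 + (r * r / 2) *\<^sub>R u0)) ** refl (g *v (r *\<^sub>R axis 1 1))"
    using refl_refl_conj[OF l] by simp
  moreover have "g *v (r *\<^sub>R axis 1 1) = r *\<^sub>R b" by (simp add: matrix_vector_mult_scaleR g)
  moreover have "g *v (r *\<^sub>R axis 1 1 + (r * r / 2) *\<^sub>R u0) = (r * k) *\<^sub>R a"
  proof -
    have "(r * r / 2) / m = r * k" using m by (simp add: r_def)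
    then have "g *v (r *\<^sub>R axis 1 1 + (r * r / 2) *\<^sub>R u0) = r *\<^sub>R b + (r * k) *\<^sub>R u"
      by (simp add: matrix_vector_right_distrib matrix_vector_mult_scaleR g gu)
    also have "\<dots> = (r * k) *\<^sub>R a + (r - r * (k * k)) *\<^sub>R b" by (simp add: u_def algebra_simps)
    finally show ?thesis using k by simp
  qed
  moreover have "r * k \<noteq> 0" using r k by auto
  ultimately have "refl a ** refl b = g ** eich (r *\<^sub>R axis 1 1) ** matrix_inv g"
    using refl_scaleR[of "r * k" a] refl_scaleR[OF r, of b] by simp
  moreover have "g *v u0 \<in> span {a, b}"
    unfolding gu u_def span_pair by (intro exI[of _ "1 / m"] exI[of _ "- k / m"]) (simp add: algebra_simps)
  ultimately show thesis using that g(1,4) r by blast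
qed

section \<open>The kind of a product of two reflections and its sets F and T\<close>

lemma pure_hyp_refl_refl: "upair a b \<Longrightarrow> (lform a b)\<^sup>2 > 1 \<Longrightarrow> pure_hyp (refl a ** refl b)"
  using hyperbolic_normal_form[of a b] opi_refl_refl[of a b] upairD[of a b]
  unfolding pure_hyp_def by (metis zero_less_one)

lemma pure_par_refl_refl: 
  assumes "upair a b" "(lform a b)\<^sup>2 = 1" shows "pure_par (refl a ** refl b)"
proof -
  obtain g r where "opi g" "r \<noteq> 0" "refl a ** refl b = g ** eich (r *\<^sub>R axis 1 1) ** matrix_inv g"
    using parabolic_normal_form[OF assms] by blast
  moreover have "r *\<^sub>R axis 1 1 \<noteq> (0 :: vec5)" using \<open>r \<noteq> 0\<close> by (simp add: axis_eq_0_iff)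
  ultimately show ?thesis
    using opi_refl_refl[of a b] upairD[OF assms(1)] spatial_axis_1[of r] unfolding pure_par_def by fastforce
qed

lemma atomic_refl_refl: "upair a b \<Longrightarrow> atomic (refl a ** refl b)"
  using pure_hyp_refl_refl[of a b] pure_par_refl_refl[of a b] ell1_refl_refl[of a b]
  unfolding atomic_def by (meson linorder_cases)

text \<open>Converse to \<open>Fset_elim\<close>: the normal forms were arranged so that b stays
  visible in the model, on the axis in the hyperbolic case and as the direction of translation in
  the parabolic one.\<close>

lemma Fset_refl_refl: assumes "upair a b" shows "lorth {b} \<in> Fset (refl a ** refl b)"
proof -
  note ab = upairD[OF assms]
  have hp: "hyperplane (lorth {b})" using ab by (auto simp: hyperplane_iff)
  consider "(lform a b)\<^sup>2 < 1" | "(lform a b)\<^sup>2 > 1" | "(lform a b)\<^sup>2 = 1" by linarith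
  then show ?thesis
  proof cases
    case 1
    have "lorth {a, b} \<subseteq> lorth {b}" by (rule lorth_antimono) simp
    then show ?thesis unfolding Fset_def using ell1_refl_refl[OF assms 1] hp by blast
  next
    case 2
    obtain g t where "opi g" "t \<noteq> 0" "refl a ** refl b = g ** boost t ** matrix_inv g" "b \<in> img g L0"
      using hyperbolic_normal_form[OF assms 2] by metis
    moreover from this(4) have "hyp_orth (lorth {b}) (img g L0)" 
      unfolding hyp_orth_def using ab by (intro exI[of _ b]) simp
    ultimately show ?thesis unfolding Fset_def using pure_hyp_refl_refl[OF assms 2] hp by blast
  next
    case 3
    obtain g r where g: "opi g" "r \<noteq> 0" "refl a ** refl b = g ** eich (r *\<^sub>R axis 1 1) ** matrix_inv g"
      "g *v axis 1 1 = b" using parabolic_normal_form[OF assms 3] by metis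
    have "lorth {r *\<^sub>R axis 1 1} \<in> Fpar0 (r *\<^sub>R axis 1 1)"
      unfolding Fpar0_def by (auto intro!: exI[of _ 0])
    moreover have "lorth {b} = img g (lorth {r *\<^sub>R axis 1 1})"
      using g(2) by (auto simp: img_lorth[OF opi_liso[OF g(1)]] matrix_vector_mult_scaleR g(4) in_lorth lform_bilin)
    moreover have "r *\<^sub>R axis 1 1 \<noteq> (0 :: vec5)" using g(2) by (simp add: axis_eq_0_iff)
    ultimately show ?thesis unfolding Fset_def 
      using pure_par_refl_refl[OF assms 3] spatial_axis_1[of r] g(1,3) by blast
  qed
qed

lemma Tset_refl_refl:
  assumes "upair a b" "lform c c = 1" "c \<in> lorth {a, b}" shows "lorth {c} \<in> Tset (refl a ** refl b)"
proof -
  note ab = upairD[OF assms(1)]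
  have hp: "hyperplane (lorth {c})" using assms by (auto simp: hyperplane_iff)
  have cs: "lform c x = 0" if "x \<in> span {a, b}" for x
    using assms(3) that unfolding span_pair by (auto simp: in_lorth lform_bilin)
  consider "(lform a b)\<^sup>2 < 1" | "(lform a b)\<^sup>2 > 1" | "(lform a b)\<^sup>2 = 1" by linarith
  then show ?thesis
  proof cases
    case 1
    have "hyp_orth (lorth {c}) (lorth {a, b})" unfolding hyp_orth_def using assms by (intro exI[of _ c]) simp
    then show ?thesis unfolding Tset_def using ell1_refl_refl[OF assms(1) 1] hp by blast
  next
    case 2
    obtain g t where "opi g" "t \<noteq> 0" "refl a ** refl b = g ** boost t ** matrix_inv g" "img g L0 \<subseteq> span {a, b}"
      using hyperbolic_normal_form[OF assms(1) 2] by metis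
    moreover from this(4) have "img g L0 \<subseteq> lorth {c}" using cs by (auto simp: in_lorth lform_sym[of _ c])
    ultimately show ?thesis unfolding Tset_def using pure_hyp_refl_refl[OF assms(1) 2] hp by blast
  next
    case 3
    obtain g r where g: "opi g" "r \<noteq> 0" "refl a ** refl b = g ** eich (r *\<^sub>R axis 1 1) ** matrix_inv g"
      "g *v axis 1 1 = b" "g *v u0 \<in> span {a, b}" using parabolic_normal_form[OF assms(1) 3] .
    note l = opi_liso[OF g(1)]
    define z where "z = matrix_inv g *v c"
    have gz: "g *v z = c" by (simp add: z_def liso_inverse_mv[OF l])
    have "lform z u0 = 0" using lisoD[OF l, of z u0] cs[OF g(5)] gz by simp
    then have z40: "z $ 4 = z $ 0" by (simp add: u0_def lform_bilin lform_axis_0 lform_axis)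
    have z1: "lform z (axis 1 1) = 0" using lisoD[OF l, of z "axis 1 1"] assms(3) gz g(4) by (simp add: in_lorth)
    \<comment> \<open>Orthogonality to \<open>u0\<close> has made the coordinates 0 and 4 of z
      equal, so removing a multiple of \<open>u0\<close> leaves a spatial vector, as
      \<open>Tpar0\<close> requires.\<close>
    define w where "w = z - z $ 0 *\<^sub>R u0"
    have w: "spatial w" using z40 by (simp add: spatial_def w_def u0_def axis_component)
    have "lform z z = lform w w"
      using \<open>lform z u0 = 0\<close> by (simp add: w_def lform_bilin lform_u0 lform_sym[of u0 z])
    then have "w \<noteq> 0" using lisoD[OF l, of z z] gz assms(2) by (auto simp: lform_bilin)
    moreover have "lform w (r *\<^sub>R axis 1 1) = 0"
      using z1 lform_u0(4)[OF spatial_axis_1[of 1]] by (simp add: w_def lform_bilin)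
    moreover have "z = w + z $ 0 *\<^sub>R u0" by (simp add: w_def)
    ultimately have "lorth {z} \<in> Tpar0 (r *\<^sub>R axis 1 1)"
      unfolding Tpar0_def using w by (intro CollectI exI[of _ w] exI[of _ "z $ 0"]) simp
    moreover have "lorth {c} = img g (lorth {z})"
      by (simp add: img_lorth[OF l] gz)
    moreover have "r *\<^sub>R axis 1 1 \<noteq> (0 :: vec5)" using g(2) by (simp add: axis_eq_0_iff)
    ultimately show ?thesis unfolding Tset_def 
      using pure_par_refl_refl[OF assms(1) 3] spatial_axis_1[of r] g(1,3) by blast
  qed
qed

subsection \<open>Factorizations into half-turns\<close>

definition half_factor :: "mat5 \<Rightarrow> vec5 set \<Rightarrow> bool" where
  "half_factor M W \<longleftrightarrow> plane W \<and> (\<exists>\<alpha>. plane \<alpha> \<and> M = half_turn \<alpha> ** half_turn W)"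

text \<open>The half-turns about lorth {a, d} and lorth {b, c} then multiply to the product of the commuting
  isometries refl a refl b and refl d refl c, since refl b and refl d commute.\<close>
definition quad :: "vec5 \<Rightarrow> vec5 \<Rightarrow> vec5 \<Rightarrow> vec5 \<Rightarrow> bool" where
  "quad a b c d \<longleftrightarrow> lform a a = 1 \<and> lform b b = 1 \<and> lform c c = 1 \<and> lform d d = 1
     \<and> lform a c = 0 \<and> lform a d = 0 \<and> lform b c = 0 \<and> lform b d = 0"

lemma quadD:
  assumes "quad a b c d"
  shows "lform a a = 1" "lform b b = 1" "lform c c = 1" "lform d d = 1"
    "lform a c = 0" "lform a d = 0" "lform b c = 0" "lform b d = 0"
    "lform c a = 0" "lform d a = 0" "lform c b = 0" "lform d b = 0"
  using assms by (auto simp: quad_def lform_sym)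

lemma quad_onpair: assumes "quad a b c d" shows "onpair a d" "onpair b c"
  using assms by (auto simp: quad_def onpair_def)

lemma quad_half_turns:
  assumes "quad a b c d"
  shows "half_turn (lorth {a, d}) ** half_turn (lorth {b, c}) = (refl a ** refl b) ** (refl d ** refl c)"
proof -
  have "refl d ** refl b = refl b ** refl d" using quadD[OF assms] by (intro refl_commute)
  then show ?thesis
    using half_turn_onpair quad_onpair[OF assms] by (metis matrix_mul_assoc)
qed

lemma quad_commute:
  assumes "quad a b c d"
  shows "(refl a ** refl b) ** (refl d ** refl c) = (refl d ** refl c) ** (refl a ** refl b)"
proof -
  have swap: "refl m *v (refl n *v v) = refl n *v (refl m *v v)" if "lform m n = 0" for m n v
    using refl_commute[OF that] by (metis matrix_vector_mul_assoc)
  show ?thesis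
    unfolding matrix_eq matrix_vector_mul_assoc[symmetric]
    using quadD[OF assms] swap[of b d] swap[of b c] swap[of a d] swap[of a c] by simp
qed

lemma quad_half_factor:
  assumes "quad a b c d"
  shows "half_factor ((refl a ** refl b) ** (refl d ** refl c)) (lorth {b, c})"
  unfolding half_factor_def
  using quad_half_turns[OF assms] onpair_plane quad_onpair[OF assms] by metis

section \<open>Principal vectors and the normal form of a factorization\<close>

lemma sin_cos_combination_zero: "\<exists>t. A * sin t + B * cos t = (0 :: real)"
proof (cases "A = 0 \<and> B = 0")
  case False
  define r where "r = sqrt (A\<^sup>2 + B\<^sup>2)"
  have r: "r > 0" using False by (auto simp: r_def sum_power2_gt_zero_iff)
  have "A\<^sup>2 + B\<^sup>2 = r\<^sup>2" by (simp add: r_def)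
  moreover have "r\<^sup>2 \<noteq> 0" using r by simp
  ultimately have "(A / r)\<^sup>2 + (- B / r)\<^sup>2 = 1"
    by (simp only: power_divide power2_minus flip: add_divide_distrib) simp
  then obtain t where t: "A / r = cos t" "- B / r = sin t" using sincos_total_2pi by metis
  have "A * sin t + B * cos t = 0" using t[symmetric] r by simp
  then show ?thesis by blast
qed auto

lemma onpair_rotate:
  fixes t :: real
  assumes "onpair p q"
  defines "b \<equiv> cos t *\<^sub>R p + sin t *\<^sub>R q" and "c \<equiv> (- sin t) *\<^sub>R p + cos t *\<^sub>R q"
  shows "onpair b c" "lorth {b, c} = lorth {p, q}"
proof -
  note pq = onpairD[OF assms(1)]
  have cs: "cos t * cos t + sin t * sin t = 1" "sin t * sin t + cos t * cos t = 1"
    using sin_cos_squared_add[of t] by (simp_all add: power2_eq_square)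
  show "onpair b c" using cs by (simp add: onpair_def b_def c_def lform_bilin pq)
  have "v \<in> lorth {b, c} \<longleftrightarrow> v \<in> lorth {p, q}" for v
  proof -
    have "lform v p = cos t * lform v b - sin t * lform v c" "lform v q = sin t * lform v b + cos t * lform v c"
      using cs by (simp_all add: b_def c_def lform_bilin) algebra+
    then show ?thesis by (auto simp: in_lorth) (simp_all add: b_def c_def lform_bilin)
  qed
  then show "lorth {b, c} = lorth {p, q}" by blast
qed

text \<open>Singular value decomposition of the 2x2 matrix of lform between the two pairs. Rotating the pairs by f
  and g, the sum and the difference of the two required conditions involve only f + g and f - g respectively.\<close>
lemma principal_vectors:
  assumes mn: "onpair m1 m2" "onpair n1 n2"
  obtains a b c d where "quad a b c d" "lorth {a, d} = lorth {m1, m2}" "lorth {b, c} = lorth {n1, n2}"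
proof -
  define p where "p = lform m1 n1"
  define q where "q = lform m1 n2"
  define r where "r = lform m2 n1"
  define s where "s = lform m2 n2"
  obtain x where x: "(s - p) * sin x + (q + r) * cos x = 0" using sin_cos_combination_zero by blast
  obtain y where y: "(p + s) * sin y + (q - r) * cos y = 0" using sin_cos_combination_zero by blast
  define f where "f = (x + y) / 2"
  define g where "g = (x - y) / 2"
  have xy: "x = f + g" "y = f - g" by (simp_all add: f_def g_def field_simps)
  let ?a = "cos f *\<^sub>R m1 + sin f *\<^sub>R m2" and ?d = "(- sin f) *\<^sub>R m1 + cos f *\<^sub>R m2"
  let ?b = "cos g *\<^sub>R n1 + sin g *\<^sub>R n2" and ?c = "(- sin g) *\<^sub>R n1 + cos g *\<^sub>R n2"
  note ad = onpair_rotate[OF mn(1), of f] and bc = onpair_rotate[OF mn(2), of g]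
  have ac: "lform ?a ?c = - cos f * sin g * p + cos f * cos g * q - sin f * sin g * r + sin f * cos g * s"
    by (simp add: lform_bilin p_def q_def r_def s_def algebra_simps)
  have bd: "lform ?b ?d = - sin f * cos g * p - sin f * sin g * q + cos f * cos g * r + cos f * sin g * s"
    by (simp add: lform_bilin p_def q_def r_def s_def lform_sym[of n1 m1] lform_sym[of n1 m2]
        lform_sym[of n2 m1] lform_sym[of n2 m2] algebra_simps)
  have "lform ?a ?c + lform ?b ?d = 0"
    using x unfolding xy(1) sin_add cos_add ac bd by algebra
  moreover have "lform ?a ?c - lform ?b ?d = 0"
    using y unfolding xy(2) sin_diff cos_diff ac bd by algebra
  ultimately have "lform ?a ?c = 0" "lform ?b ?d = 0" by linarith+
  then have "quad ?a ?b ?c ?d"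
    using onpairD[OF ad(1)] onpairD[OF bc(1)] by (simp add: quad_def)
  then show thesis using that ad(2) bc(2) by blast
qed

text \<open>The component of a orthogonal to b witnesses that the span of a and b is not positive
  definite; by its square, it is null exactly in the parabolic case.\<close>

lemma upair_nonspacelike:
  assumes "upair a b" "(lform a b)\<^sup>2 \<ge> 1"
  defines "u \<equiv> a - lform a b *\<^sub>R b"
  shows "u \<noteq> 0" "lform u u = 1 - (lform a b)\<^sup>2" "lform u u \<le> 0" "u \<in> span {a, b}"
proof -
  show "u \<noteq> 0" using upair_coeffs(1)[OF assms(1), of 1 "lform a b"] by (auto simp: u_def)
  show uu: "lform u u = 1 - (lform a b)\<^sup>2"
    using upairD[OF assms(1)] by (simp add: u_def lform_bilin lform_sym[of b a] power2_eq_square)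
  then show "lform u u \<le> 0" using assms(2) by simp
  show "u \<in> span {a, b}" unfolding u_def span_pair
    by (intro exI[of _ 1] exI[of _ "- lform a b"]) simp
qed

text \<open>Exchanging a, b with d, c changes neither M, as the two factors commute, nor W. So it is
  enough that one of the two pairs is dependent or spans a definite plane; the remaining case is
  reduced to a dependent pair by new normals.\<close>

lemma half_factor_normal_form:
  assumes "half_factor M W"
  obtains a b c d where "quad a b c d" "W = lorth {b, c}" "M = (refl a ** refl b) ** (refl d ** refl c)"
    "c = d \<or> upair a b \<and> upair c d \<and> (lform c d)\<^sup>2 < 1"
proof -
  obtain m1 m2 n1 n2 where mn: "onpair m1 m2" "onpair n1 n2"
    and M0: "M = half_turn (lorth {m1, m2}) ** half_turn (lorth {n1, n2})" and W0: "W = lorth {n1, n2}"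
    using assms unfolding half_factor_def plane_iff by blast
  obtain a b c d where q: "quad a b c d" and ad: "lorth {a, d} = lorth {m1, m2}"
    and bc: "lorth {b, c} = lorth {n1, n2}"
    using principal_vectors[OF mn] .
  have W: "W = lorth {b, c}" using W0 bc by simp
  have M: "M = (refl a ** refl b) ** (refl d ** refl c)"
    using M0 quad_half_turns[OF q] ad bc by simp
  note D = quadD[OF q]
  have q': "quad d c b a" using D by (simp add: quad_def)
  have W': "W = lorth {c, b}" using W by (simp add: insert_commute)
  have M': "M = (refl d ** refl c) ** (refl a ** refl b)" using M quad_commute[OF q] by simp
  have minus: "refl (- v) = refl v" for v using refl_scaleR[of "-1" v] by simp
  consider (cd) "\<not> upair c d" | (ab) "\<not> upair a b" | (def1) "upair a b" "upair c d" "(lform c d)\<^sup>2 < 1"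
    | (def2) "upair a b" "upair c d" "(lform a b)\<^sup>2 < 1"
    | (nondef) "upair a b" "upair c d" "(lform c d)\<^sup>2 \<ge> 1" "(lform a b)\<^sup>2 \<ge> 1" by linarith
  then show thesis
  proof cases
    case cd
    then have "d = c \<or> d = - c" using D by (auto simp: upair_def)
    then have "M = (refl a ** refl b) ** (refl c ** refl c)" using M minus by auto
    moreover have "quad a b c c" using D by (simp add: quad_def)
    ultimately show thesis using that W by blast
  next
    case ab
    then have "a = b \<or> a = - b" using D by (auto simp: upair_def)
    then have "M = (refl d ** refl c) ** (refl b ** refl b)" using M' minus by auto
    moreover have "quad d c b b" using D by (simp add: quad_def)
    ultimately show thesis using that W' by blast
  next
    case def1
    then show thesis using that q W M by blast
  next
    case def2
    then have "upair d c" "upair b a" "(lform b a)\<^sup>2 < 1"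
      by (simp_all add: upair_sym[of _ c] upair_sym[of b] lform_sym)
    then show thesis using that q' W' M' by blast
  next
    \<comment> \<open>Both spans are degenerate and share their null direction, so the two normal planes have a common vector z.\<close>
    case nondef
    define k where "k = lform a b"
    define l where "l = lform d c"
    have l: "upair d c" "(lform d c)\<^sup>2 \<ge> 1"
      using nondef by (simp_all add: upair_sym[of d] lform_sym[of d])
    note u = upair_nonspacelike[OF nondef(1,4), folded k_def]
    note v = upair_nonspacelike[OF l, folded l_def]
    have "lform (a - k *\<^sub>R b) (d - l *\<^sub>R c) = 0" by (simp add: lform_bilin D)
    then obtain s where s: "d - l *\<^sub>R c = s *\<^sub>R (a - k *\<^sub>R b)"
      using orthogonal_nonspacelike_parallel[OF u(1,3) v(3)] by blast
    \<comment> \<open>Rearranging the relation just found places this vector in the span of a, d and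
      in that of b, c; normalized, it serves as the second normal of both planes and cancels from
      M.\<close>
    define z where "z = d - s *\<^sub>R a"
    have z: "z = (- s * k) *\<^sub>R b + l *\<^sub>R c" using s by (simp add: z_def algebra_simps)
    have "lform z z = 1 + s * s" by (simp add: z_def lform_bilin D)
    then have "lform z z > 0" by (smt (verit) zero_le_square)
    then obtain e where "e > 0" and e: "lform (e *\<^sub>R z) (e *\<^sub>R z) = 1" by (rule normalize_spacelike)
    have "e *\<^sub>R z \<in> span {b, c}"
      unfolding z by (intro span_scale span_add) (auto intro: span_base)
    then obtain n where n: "onpair n (e *\<^sub>R z)" "lorth {n, e *\<^sub>R z} = lorth {b, c}"
      using onpair_completion[OF quad_onpair(2)[OF q] _ e] by blast
    have "e *\<^sub>R z \<in> span {a, d}"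
      unfolding z_def by (intro span_scale span_diff) (auto intro: span_base)
    then obtain m where m: "onpair m (e *\<^sub>R z)" "lorth {m, e *\<^sub>R z} = lorth {a, d}"
      using onpair_completion[OF quad_onpair(1)[OF q] _ e] by blast
    have q2: "quad m n (e *\<^sub>R z) (e *\<^sub>R z)"
      using m(1) n(1) unfolding quad_def onpair_def by blast
    have "M = (refl m ** refl n) ** (refl (e *\<^sub>R z) ** refl (e *\<^sub>R z))"
      using quad_half_turns[OF q2] M0 m(2) n(2) ad bc by simp
    then show thesis using that q2 W n(2) by metis
  qed
qed

section \<open>Elements of the bank are half-turn factors\<close>

lemma plane_timelike: assumes "plane P" obtains v where "v \<in> P" "lform v v < 0"
  using assms by (auto simp: geod_def)

lemma lorth_plane_positive:
  assumes "plane P" "y \<in> lorth P" "y \<noteq> 0" shows "lform y y > 0"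
proof -
  obtain v where "v \<in> P" "lform v v < 0" using plane_timelike[OF assms(1)] .
  then show ?thesis using orthogonal_timelike_spacelike[of v y] assms(2,3) by (auto simp: lorth_def lform_sym)
qed

lemma refl_refl_diff_span:
  assumes "lform a a = 1" "lform b b = 1" shows "(refl a ** refl b) *v v - v \<in> span {a, b}"
  unfolding refl_refl_mv[OF assms] span_pair
  by (intro exI[of _ "- (2 * lform v a - 4 * lform a b * lform v b)"] exI[of _ "- (2 * lform v b)"])
    (simp add: algebra_simps)

text \<open>If y = T x - x were nonzero, it would be a spacelike vector in the positive definite T-invariant space
  lorth P. Writing T = refl a' refl y, either a' is orthogonal to y or a' also lies in lorth P; in both
  cases T fixes a timelike vector.\<close>
lemma commuting_rotation_orthogonal:
  assumes ab: "lform a a = 1" "lform b b = 1" and T: "T = refl a ** refl b"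
    and notime: "\<And>v. T *v v = v \<Longrightarrow> lform v v \<ge> 0"
    and R: "ell1 R P" and comm: "T ** R = R ** T" and x: "x \<in> lorth P"
  shows "T *v x = x"
proof (rule ccontr)
  assume "T *v x \<noteq> x"
  define y where "y = T *v x - x"
  have y0: "y \<noteq> 0" using \<open>T *v x \<noteq> x\<close> by (simp add: y_def)
  have P: "plane P" using R by (simp add: ell1_def)
  have T_iso: "liso T" unfolding T using ab by (intro liso_mult refl_liso) auto
  \<comment> \<open>P is the fixed space of R and T commutes with R, so T preserves P and therefore
    also its complement.\<close>
  have inv: "matrix_inv T *v p \<in> P" if "p \<in> P" for p
  proof -
    have "T *v (R *v (matrix_inv T *v p)) = R *v (T *v (matrix_inv T *v p))"
      using comm by (metis matrix_vector_mul_assoc)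
    also have "\<dots> = p" using that ell1_fixed[OF R] by (simp add: liso_inverse_mv[OF T_iso])
    finally have "R *v (matrix_inv T *v p) = matrix_inv T *v p" by (metis liso_inverse_mv(2)[OF T_iso])
    then show ?thesis using ell1_fixed[OF R] by simp
  qed
  have TP: "T *v w \<in> lorth P" if "w \<in> lorth P" for w
    unfolding lorth_def
  proof safe
    fix p assume p: "p \<in> P"
    have "lform (T *v w) (T *v (matrix_inv T *v p)) = 0"
      unfolding lisoD[OF T_iso] using that inv[OF p] by (auto simp: lorth_def)
    then show "lform (T *v w) p = 0" by (simp add: liso_inverse_mv[OF T_iso])
  qed
  have yP: "y \<in> lorth P" unfolding y_def using TP[OF x] x by (intro subspace_diff subspace_lorth)
  have yy: "lform y y > 0" by (rule lorth_plane_positive[OF P yP y0])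
  have "y \<in> span {a, b}" unfolding y_def T using ab by (rule refl_refl_diff_span)
  then obtain s t where "y = s *\<^sub>R a + t *\<^sub>R b" by (auto simp: span_pair)
  then obtain a' where a': "lform a' a' = lform y y" "T = refl a' ** refl y"
    using three_reflections[OF ab, of y s t] yy T by auto
  obtain v where v: "lform v v < 0" "lform v a' = 0" "lform v y = 0"
  proof (cases "lform y a' = 0")
    \<comment> \<open>The vectors y and a' have the same length, so a common rescaling makes them
      orthonormal and a timelike vector orthogonal to both exists.\<close>
    case True
    obtain c where c: "c > 0" "lform (c *\<^sub>R y) (c *\<^sub>R y) = 1" using normalize_spacelike[OF yy] .
    have "onpair (c *\<^sub>R y) (c *\<^sub>R a')" using c a'(1) True by (simp add: onpair_def lform_bilin)
    then obtain v where "v \<in> lorth {c *\<^sub>R y, c *\<^sub>R a'}" "lform v v < 0" by (rule onpair_timelike_orthogonal)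
    then show thesis using that[of v] c(1) by (simp add: in_lorth lform_bilin)
  next
    case False
    define r where "r = 2 * lform y a' / lform y y"
    have r: "r \<noteq> 0" using False yy by (simp add: r_def)
    \<comment> \<open>T sends y to a combination of y and a' with a nonzero coefficient at a', so a'
      is recovered from y and T y, which both lie in \<open>lorth P\<close>.\<close>
    have "T *v y = refl a' *v (- y)"
      using yy refl_self[of y] by (simp add: a'(2) flip: matrix_vector_mul_assoc)
    also have "\<dots> = - y + r *\<^sub>R a'"
      by (simp add: refl_mv a'(1) r_def lform_bilin)
    finally have "a' = (1 / r) *\<^sub>R (T *v y + y)" using r by simp
    then have "a' \<in> lorth P" using TP[OF yP] yP
      by (auto intro: subspace_scale subspace_add subspace_lorth)
    moreover obtain v where "v \<in> P" "lform v v < 0" using plane_timelike[OF P] .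
    ultimately show thesis using that[of v] yP by (auto simp: lorth_def lform_sym)
  qed
  have "T *v v = v" using v by (simp add: a'(2) refl_orthogonal flip: matrix_vector_mul_assoc)
  then show False using notime v(1) by force
qed

text \<open>The directions of P2 at x are orthogonal to all of P1, and by dimension they exhaust
  \<open>lorth P1\<close>. Thus the normals of P1 lie in P2 and are orthogonal to the normals of
  P2.\<close>

lemma orth_at_lorth:
  assumes o: "orth_at P1 P2 x" and x: "lform x x = -1" and P1: "plane P1" and P2: "plane P2"
    and v: "v \<in> lorth P1" and w: "w \<in> lorth P2"
  shows "lform v w = 0"
proof -
  have sub: "subspace P1" "subspace P2" and dims: "dim P1 = 3" "dim P2 = 3"
    using P1 P2 by (auto simp: geod_def)
  have xP: "x \<in> P1" "x \<in> P2" using o span_base[of x "{x}"] by (auto simp: orth_at_def)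
  define A where "A = lorth (insert x (lorth P2))"
  have A: "u \<in> A \<longleftrightarrow> lform u x = 0 \<and> u \<in> P2" for u
    by (simp add: A_def lorth_insert lorth_lorth_subspace[OF sub(2)])
  have "A \<subseteq> lorth P1"
  proof
    fix u assume u: "u \<in> A"
    have "lform u p = 0" if "p \<in> P1" for p
    proof -
      define p' where "p' = p + lform p x *\<^sub>R x"
      have "p' \<in> P1 \<inter> lorth {x}"
        using that xP sub x by (auto simp: p'_def in_lorth lform_bilin intro: subspace_add subspace_scale)
      moreover have "u \<in> P2 \<inter> lorth {x}" using u A by (simp add: in_lorth)
      ultimately have "lform p' u = 0" using o by (simp add: orth_at_def)
      then show ?thesis using u A by (simp add: p'_def lform_bilin lform_sym[of x u] lform_sym[of p u])
    qed
    then show "u \<in> lorth P1" by (simp add: lorth_def)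
  qed
  moreover have "dim (insert x (lorth P2)) \<le> 3"
    using dim_lorth[of P2] dims by (simp add: dim_insert)
  then have "dim (lorth P1) \<le> dim A"
    using dim_lorth[of "insert x (lorth P2)"] dim_lorth[of P1] dims by (simp add: A_def)
  ultimately have "A = lorth P1"
    by (intro subspace_dim_equal) (auto simp: A_def subspace_lorth)
  then have "v \<in> P2" using v A by blast
  then show ?thesis using w by (auto simp: lorth_def lform_sym)
qed

lemma Fset_elim_plane:
  assumes "ell1 R P" "s \<in> Fset R"
  obtains a b where "lform a a = 1" "lform b b = 1" "s = lorth {b}" "R = refl a ** refl b"
    "a \<in> lorth P" "b \<in> lorth P"
proof -
  obtain a b where ab: "lform a a = 1" "lform b b = 1" "s = lorth {b}" "R = refl a ** refl b"
    using Fset_elim[OF assms(2)] .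
  have "atomic R" using assms(1) by (auto simp: atomic_def)
  then have "upair a b" using upair_if_not_id[OF ab(1,2)] atomic_not_id ab(4) by simp
  then have "P = lorth {a, b}" using refl_refl_fixed[of a b] ell1_fixed[OF assms(1)] ab(4) by blast
  then have "lorth P = span {a, b}" by (simp add: lorth_lorth)
  then show thesis using that[OF ab] by (simp add: span_base)
qed

text \<open>M is minus the identity on the positive definite complement of x. The normals b, c of
  any plane through x lie there and extend to an orthonormal basis, whose four reflections multiply
  to M.\<close>

lemma antipodal_half_factor:
  assumes M: "ell2 M x" "M ** M = mat 1" and W: "plane W" "x \<in> W"
  shows "half_factor M W"
proof -
  have x: "lform x x = -1" and hx: "M *v x = x"
    using M(1) by (auto simp: ell2_def fixpts_def hyp_pt_def)
  have iso: "lform (M *v v) (M *v w) = lform v w" for v w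
    using M(1) by (simp add: ell2_def opi_def)
  have neg: "M *v v = - v" if "lform v x = 0" for v
  proof -
    \<comment> \<open>The sum is fixed because M is an involution, hence a multiple of x; as it is
      also orthogonal to x, it vanishes.\<close>
    have "M *v (M *v v + v) = M *v v + v"
      using M(2) by (simp add: matrix_vector_right_distrib matrix_vector_mul_assoc add.commute)
    then obtain k where k: "M *v v + v = k *\<^sub>R x" using ell2_fixed[OF M(1)] by (auto simp: span_singleton)
    have "lform (M *v v + v) x = 0" using iso[of v x] hx that by (simp add: lform_bilin)
    then have "k = 0" unfolding k by (simp add: lform_bilin x)
    then show ?thesis using k by (simp add: eq_neg_iff_add_eq_0)
  qed
  obtain b c where bc: "onpair b c" "W = lorth {b, c}" using W(1) by (auto simp: plane_iff)
  note B = onpairD[OF bc(1)]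
  have xbc: "lform x b = 0" "lform x c = 0" using W(2) bc(2) by (auto simp: in_lorth)
  define Q where "Q = lorth {x, b, c}"
  have "x \<notin> span {b, c}" by (rule lorth_not_in_span) (use xbc x in \<open>auto simp: in_lorth\<close>)
  then have "dim {x, b, c} = 3" using onpair_independent(3)[OF bc(1)] by (simp add: dim_insert)
  then have "dim Q = 2" using dim_lorth[of "{x, b, c}"] by (simp add: Q_def)
  moreover have "lform v v > 0" if "v \<in> Q" "v \<noteq> 0" for v
    using orthogonal_timelike_spacelike[of x v] that x by (simp add: Q_def in_lorth lform_sym[of x v])
  ultimately obtain a d where ad: "onpair a d" "Q = span {a, d}"
    using definite_orthonormal_basis[of Q] subspace_lorth[of "{x, b, c}"] unfolding Q_def by metis
  note A = onpairD[OF ad(1)]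
  have aQ: "a \<in> Q" "d \<in> Q" using ad(2) by (auto intro: span_base)
  then have o: "lform a x = 0" "lform a b = 0" "lform a c = 0" "lform d x = 0" "lform d b = 0" "lform d c = 0"
    by (auto simp: Q_def in_lorth)
  have q: "quad a b c d" using A B o by (simp add: quad_def lform_sym[of b d])
  have "M = (refl a ** refl b) ** (refl d ** refl c)"
    unfolding matrix_eq
  proof
    fix v
    define w where "w = v + lform v x *\<^sub>R x"
    have wx: "lform w x = 0" by (simp add: w_def lform_bilin x)
    define z where "z = w - lform w b *\<^sub>R b - lform w c *\<^sub>R c"
    have "z \<in> Q" using wx xbc B by (simp add: z_def Q_def in_lorth lform_bilin lform_sym[of _ x])
    then have "z = lform z a *\<^sub>R a + lform z d *\<^sub>R d" using onpair_expansion[OF ad(1)] ad(2) by blast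
    moreover have "lform z a = lform v a" "lform z d = lform v d"
      using o by (simp_all add: z_def w_def lform_bilin lform_sym[of b a] lform_sym[of c a]
         lform_sym[of b d] lform_sym[of c d] lform_sym[of x a] lform_sym[of x d])
    moreover have "lform w b = lform v b" "lform w c = lform v c"
      using xbc by (simp_all add: w_def lform_bilin)
    ultimately have w: "w = lform v a *\<^sub>R a + lform v b *\<^sub>R b + lform v c *\<^sub>R c + lform v d *\<^sub>R d"
      by (simp add: z_def algebra_simps)
    have "M *v v = M *v (w - lform v x *\<^sub>R x)" by (simp add: w_def)
    also have "\<dots> = - w - lform v x *\<^sub>R x"
      using neg[OF wx] hx by (simp add: matrix_vector_mult_diff_distrib matrix_vector_mult_scaleR)
    also have "\<dots> = v - w - w" by (simp add: w_def)
    also have "\<dots> = v - 2 *\<^sub>R w" by (simp only: scaleR_2 diff_diff_eq)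
    also have "\<dots> = ((refl a ** refl b) ** (refl d ** refl c)) *v v"
      using A B o unfolding w
      by (simp add: refl_unit lform_bilin lform_sym[of b a] lform_sym[of c d] lform_sym[of c a] lform_sym[of c b]
         lform_sym[of b d] scaleR_add_right diff_diff_eq add_ac flip: matrix_vector_mul_assoc)
    finally show "M *v v = ((refl a ** refl b) ** (refl d ** refl c)) *v v" .
  qed
  then show ?thesis using quad_half_factor[OF q] bc(2) by simp
qed

text \<open>The normal of t is fixed by M, hence orthogonal to both mirror normals; used as a second
  normal for both planes, its reflection cancels.\<close>

lemma atomic_half_factor:
  assumes "atomic M" "s \<in> Fset M" "t \<in> Tset M" shows "half_factor M (s \<inter> t)"
proof -
  obtain a b where ab: "lform a a = 1" "lform b b = 1" "s = lorth {b}" "M = refl a ** refl b"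
    using Fset_elim[OF assms(2)] .
  obtain c where c: "lform c c = 1" "t = lorth {c}" "M *v c = c" using Tset_elim[OF assms(3)] .
  have "upair a b" using upair_if_not_id[OF ab(1,2)] atomic_not_id[OF assms(1)] ab(4) by simp
  then have "c \<in> lorth {a, b}" using refl_refl_fixed c(3) ab(4) by simp
  then have q: "quad a b c c" using ab c by (simp add: quad_def in_lorth lform_sym[of a c] lform_sym[of b c])
  have "refl c ** refl c = mat 1" using c(1) by (simp add: refl_involution)
  then show ?thesis using quad_half_factor[OF q] ab c by (simp add: lorth_Int insert_commute)
qed

text \<open>The given factors are only known to commute. As \<tau> fixes no timelike vector,
  \<open>commuting_rotation_orthogonal\<close> makes it fix \<open>lorth P\<close>, and this gives
  the orthogonality demanded by \<open>quad\<close>.\<close>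

lemma screw_half_factor:
  assumes M: "M = \<tau> ** \<rho>" "\<tau> ** \<rho> = \<rho> ** \<tau>" and \<tau>: "pure_hyp \<tau> \<or> pure_par \<tau>"
    and \<rho>: "ell1 \<rho> P" and s: "s \<in> Fset \<tau>" and t: "hyperplane t" "P \<subseteq> t"
  shows "half_factor M (s \<inter> t)"
proof -
  obtain a b where ab: "lform a a = 1" "lform b b = 1" "s = lorth {b}" "\<tau> = refl a ** refl b"
    using Fset_elim[OF s] .
  have at: "atomic \<tau>" "atomic \<rho>" using \<tau> \<rho> by (auto simp: atomic_def)
  have up: "upair a b" using upair_if_not_id[OF ab(1,2)] atomic_not_id[OF at(1)] ab(4) by simp
  obtain c where c: "lform c c = 1" "t = lorth {c}" using t(1) by (auto simp: hyperplane_iff)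
  have cP: "c \<in> lorth P" using c(2) t(2) by (auto simp: lorth_def lform_sym)
  obtain d where d: "lform d d = 1" "\<rho> = refl d ** refl c" using ell1_refl_decomposition[OF \<rho> c(1) cP] .
  have "upair d c" using upair_if_not_id[OF d(1) c(1)] atomic_not_id[OF at(2)] d(2) by simp
  then have "P = lorth {d, c}" using refl_refl_fixed[of d c] ell1_fixed[OF \<rho>] d(2) by blast
  then have dP: "d \<in> lorth P" by (simp add: lorth_lorth span_base)
  have notime: "lform v v \<ge> 0" if "\<tau> *v v = v" for v
    using \<tau> pure_hyp_fixed[of \<tau> v] pure_par_fixed[of \<tau> v] that by (cases "v = 0") (auto simp: lform_bilin)
  have "\<tau> *v x = x" if "x \<in> lorth P" for x
    by (rule commuting_rotation_orthogonal[OF ab(1,2,4) notime \<rho> M(2) that])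
  then have "c \<in> lorth {a, b}" "d \<in> lorth {a, b}"
    using refl_refl_fixed[OF up] cP dP ab(4) by auto
  then have q: "quad a b c d"
    using ab c d by (simp add: quad_def in_lorth lform_sym[of a c] lform_sym[of b c] lform_sym[of a d] lform_sym[of b d])
  show ?thesis using quad_half_factor[OF q] ab c d M(1) by (simp add: lorth_Int insert_commute)
qed

lemma double_rotation_half_factor:
  assumes M: "M = \<rho>1 ** \<rho>2" and \<rho>: "ell1 \<rho>1 P1" "ell1 \<rho>2 P2" and o: "orth_at P1 P2 x" "lform x x = -1"
    and s: "s \<in> Fset \<rho>1" and t: "t \<in> Fset \<rho>2"
  shows "half_factor M (s \<inter> t)"
proof -
  obtain a b where ab: "lform a a = 1" "lform b b = 1" "s = lorth {b}" "\<rho>1 = refl a ** refl b"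
    "a \<in> lorth P1" "b \<in> lorth P1" using Fset_elim_plane[OF \<rho>(1) s] .
  obtain d c where dc: "lform d d = 1" "lform c c = 1" "t = lorth {c}" "\<rho>2 = refl d ** refl c"
    "d \<in> lorth P2" "c \<in> lorth P2" using Fset_elim_plane[OF \<rho>(2) t] .
  have "plane P1" "plane P2" using \<rho> by (auto simp: ell1_def)
  then have q: "quad a b c d" using orth_at_lorth[OF o] ab dc by (simp add: quad_def)
  show ?thesis using quad_half_factor[OF q] ab dc M by (simp add: lorth_Int insert_commute)
qed

lemma id_half_factor: assumes "plane W" shows "half_factor (mat 1) W"
proof -
  obtain b c where bc: "onpair b c" "W = lorth {b, c}" using assms by (auto simp: plane_iff)
  have q: "quad b b c c" using onpairD[OF bc(1)] by (simp add: quad_def)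
  show ?thesis using quad_half_factor[OF q] onpairD[OF bc(1)] bc(2) by (simp add: refl_involution)
qed

lemma Kbank_half_factor: assumes "W \<in> Kbank M" shows "half_factor M W"
proof -
  consider "M = mat 1" "plane W"
    | s t where "atomic M" "s \<in> Fset M" "t \<in> Tset M" "W = s \<inter> t"
    | \<tau> \<rho> P s t where "M = \<tau> ** \<rho>" "\<tau> ** \<rho> = \<rho> ** \<tau>" "pure_hyp \<tau> \<or> pure_par \<tau>" "ell1 \<rho> P"
        "s \<in> Fset \<tau>" "hyperplane t" "P \<subseteq> t" "W = s \<inter> t"
    | x \<rho>1 \<rho>2 P1 P2 s t where "ell2 M x" "M = \<rho>1 ** \<rho>2" "ell1 \<rho>1 P1" "ell1 \<rho>2 P2" "orth_at P1 P2 x"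
        "s \<in> Fset \<rho>1" "t \<in> Fset \<rho>2" "W = s \<inter> t"
    | x where "ell2 M x" "M ** M = mat 1" "plane W" "x \<in> W"
    using assms unfolding Kbank_def mem_Collect_eq by metis
  then show ?thesis
  proof cases
    case 3
    then show ?thesis using screw_half_factor by blast
  next
    case 4
    then have "lform x x = -1" by (auto simp: ell2_def fixpts_def hyp_pt_def)
    then show ?thesis using 4 double_rotation_half_factor by blast
  qed (auto simp: id_half_factor atomic_half_factor antipodal_half_factor)
qed

subsection \<open>Every half-turn factor lies in the bank\<close>

text \<open>The case of \<open>half_factor_normal_form\<close> in which both factors are nontrivial:
  \<open>refl d ** refl c\<close> is a rotation about a plane, while \<open>refl a ** refl b\<close>
  may be of any atomic kind.\<close>

definition rquad :: "vec5 \<Rightarrow> vec5 \<Rightarrow> vec5 \<Rightarrow> vec5 \<Rightarrow> bool" where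
  "rquad a b c d \<longleftrightarrow> quad a b c d \<and> upair a b \<and> upair c d \<and> (lform c d)\<^sup>2 < 1"

lemma rquadD:
  assumes "rquad a b c d"
  shows "quad a b c d" "upair a b" "upair d c" "(lform d c)\<^sup>2 < 1"
  using assms by (auto simp: rquad_def upair_sym[of d] lform_sym[of d c])

text \<open>Each factor displaces vectors along its own span only, and the other factor ignores that
  span; so displacements add.\<close>

lemma quad_mv:
  assumes "quad a b c d"
  shows "((refl a ** refl b) ** (refl d ** refl c)) *v v
    = (refl a ** refl b) *v v + (refl d ** refl c) *v v - v"
proof -
  note D = quadD[OF assms]
  let ?w = "(refl d ** refl c) *v v"
  have "lform ?w a = lform v a" "lform ?w b = lform v b"
    by (simp_all add: refl_refl_mv D lform_bilin)
  then have "(refl a ** refl b) *v ?w - ?w = (refl a ** refl b) *v v - v"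
    by (simp add: refl_refl_mv[OF D(1,2)])
  then show ?thesis by (simp add: algebra_simps flip: matrix_vector_mul_assoc)
qed

lemma quad_span_orthogonal:
  assumes "quad a b c d" "p \<in> span {a, b}" "q \<in> span {d, c}" shows "lform p q = 0"
  using assms(2,3) quadD[OF assms(1)] by (auto simp: span_pair lform_bilin)

lemma rquad_plane: "rquad a b c d \<Longrightarrow> plane (lorth {d, c})"
  using upair_definite_plane rquadD by blast

lemma rquad_ell1: "rquad a b c d \<Longrightarrow> ell1 (refl d ** refl c) (lorth {d, c})"
  using ell1_refl_refl rquadD by blast

lemma rquad_positive: "rquad a b c d \<Longrightarrow> z \<in> span {d, c} \<Longrightarrow> z \<noteq> 0 \<Longrightarrow> lform z z > 0"
  using lorth_plane_positive[OF rquad_plane] by (simp add: lorth_lorth)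

text \<open>A common vector would be orthogonal to itself inside a definite plane. Consequently an
  equation between displacements can be read in the two spans separately.\<close>

lemma rquad_span_Int:
  assumes "rquad a b c d" "z \<in> span {a, b}" "z \<in> span {d, c}" shows "z = 0"
  using rquad_positive[OF assms(1,3)] quad_span_orthogonal[OF rquadD(1)[OF assms(1)] assms(2,3)] by auto

lemma rquad_fixed:
  assumes r: "rquad a b c d"
  shows "((refl a ** refl b) ** (refl d ** refl c)) *v v = v \<longleftrightarrow> v \<in> lorth {a, b} \<and> v \<in> lorth {d, c}"
proof -
  note D = quadD[OF rquadD(1)[OF r]]
  let ?p = "(refl a ** refl b) *v v - v" and ?q = "(refl d ** refl c) *v v - v"
  have p: "?p \<in> span {a, b}" by (rule refl_refl_diff_span[OF D(1,2)])
  have q: "?q \<in> span {d, c}" by (rule refl_refl_diff_span[OF D(4,3)])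
  have "((refl a ** refl b) ** (refl d ** refl c)) *v v = v \<longleftrightarrow> ?p = - ?q"
    unfolding quad_mv[OF rquadD(1)[OF r]] by (auto simp: algebra_simps)
  also have "\<dots> \<longleftrightarrow> ?p = 0 \<and> ?q = 0"
    using rquad_span_Int[OF r p] span_neg[OF q] by auto
  also have "\<dots> \<longleftrightarrow> v \<in> lorth {a, b} \<and> v \<in> lorth {d, c}"
    using refl_refl_fixed[OF rquadD(2)[OF r]] refl_refl_fixed[OF rquadD(3)[OF r]] by simp
  finally show ?thesis .
qed

section \<open>Types of products with a rotational factor\<close>

text \<open>A dimension count separates screw motions from pure ones: the fixed space of the left
  side is orthogonal to the independent vectors a, b, c, while a product of two reflections fixes
  the complement of a space of dimension at most 2.\<close>

lemma rquad_not_refl_refl: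
  assumes r: "rquad a b c d" and ef: "lform e e = 1" "lform f f = 1"
  shows "(refl a ** refl b) ** (refl d ** refl c) \<noteq> refl e ** refl f"
proof
  assume eq: "(refl a ** refl b) ** (refl d ** refl c) = refl e ** refl f"
  note D = quadD[OF rquadD(1)[OF r]]
  have fixed: "v \<in> lorth {a, b} \<and> v \<in> lorth {d, c}" if "v \<in> lorth {e, f}" for v
  proof -
    have "(refl e ** refl f) *v v = v" using that by (simp add: refl_refl_mv[OF ef] in_lorth)
    then show ?thesis using rquad_fixed[OF r] eq by simp
  qed
  then have "{c, a, b} \<subseteq> lorth (lorth {e, f})"
    by (auto simp: in_lorth lform_sym[of c] lform_sym[of a] lform_sym[of b]) (auto simp: lorth_def lform_sym)
  then have sub: "{c, a, b} \<subseteq> span {e, f}" by (simp add: lorth_lorth)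
  have "b \<noteq> 0" using D by (auto simp: lform_bilin)
  then have "independent {b}" by (simp add: independent_insert)
  moreover have "a \<notin> span {b}"
    using unit_multiple[OF D(1,2)] rquadD(2)[OF r] by (auto simp: span_singleton upair_def)
  ultimately have "independent {a, b}" by (rule independent_insertI[rotated])
  moreover have c: "c \<notin> span {a, b}" by (rule lorth_not_in_span) (use D in \<open>auto simp: in_lorth\<close>)
  ultimately have "independent {c, a, b}" by (rule independent_insertI[rotated])
  then have "card {c, a, b} \<le> dim (span {e, f})" using sub by (rule independent_card_le_dim[rotated])
  moreover have "card {c, a, b} = 3"
    using c span_base[of a "{a, b}"] span_base[of b "{a, b}"] rquadD(2)[OF r]
    by (auto simp: card_insert_if upair_def)
  moreover have "dim (span {e, f}) \<le> 2"
    using dim_le_card[of "{e, f}"  "{e, f}"] card_insert_le_m1[of 2 "{f}" e]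
    by (simp add: span_superset)
  ultimately show False by simp
qed

lemma pure_refl_refl:
  assumes "pure_hyp M \<or> pure_par M"
  obtains a b where "lform a a = 1" "lform b b = 1" "M = refl a ** refl b"
proof -
  have "\<exists>s. s \<in> Fset M"
  proof (cases "pure_hyp M")
    case True
    then obtain g t where g: "opi g" "t \<noteq> 0" "M = g ** boost t ** matrix_inv g" by (auto simp: pure_hyp_def)
    let ?n = "g *v axis 4 1"
    have n: "lform ?n ?n = 1" using lisoD[OF opi_liso[OF g(1)]] by (simp add: lform_axis_axis)
    moreover have "?n \<in> img g L0" by (auto simp: img_def L0_def intro: span_base)
    ultimately have "hyp_orth (lorth {?n}) (img g L0)"
      unfolding hyp_orth_def by (intro exI[of _ ?n]) simp
    moreover have "hyperplane (lorth {?n})" using n by (auto simp: hyperplane_iff)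
    ultimately have "lorth {?n} \<in> Fset M" unfolding Fset_def using g True by blast
    then show ?thesis ..
  next
    case False
    then have p: "pure_par M" using assms by simp
    then obtain g a where g: "opi g" "spatial a" "a \<noteq> 0" "M = g ** eich a ** matrix_inv g"
      by (auto simp: pure_par_def)
    have "lorth {a + 0 *\<^sub>R u0} \<in> Fpar0 a" unfolding Fpar0_def by blast
    then have "img g (lorth {a + 0 *\<^sub>R u0}) \<in> Fset M" unfolding Fset_def using g p by blast
    then show ?thesis ..
  qed
  then show thesis using Fset_elim that by metis
qed

lemma rquad_not_pure:
  assumes "rquad a b c d"
  shows "\<not> pure_hyp ((refl a ** refl b) ** (refl d ** refl c))"
    "\<not> pure_par ((refl a ** refl b) ** (refl d ** refl c))"
  using pure_refl_refl[of "(refl a ** refl b) ** (refl d ** refl c)"] rquad_not_refl_refl[OF assms]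
  by metis+

text \<open>Pairing w with the time axis and with its image under M gives opposite signs, although
  both vectors are on the future sheet, where the sign is determined by w alone.\<close>

lemma opi_eigenvalue_minus_one:
  assumes "opi M" "lform w w \<le> 0" "w \<noteq> 0" "M *v w = - w" shows False
proof -
  define e :: vec5 where "e = axis 0 1"
  have e: "hyp_pt e" by (simp add: e_def hyp_pt_def lform_axis_axis axis_component)
  then have Me: "hyp_pt (M *v e)" using assms(1) by (simp add: opi_def)
  have "lform (M *v e) (M *v w) = lform e w" using assms(1) by (simp add: opi_def)
  then have "lform (M *v e) w = - lform e w" using assms(4) by (simp add: lform_bilin)
  moreover have "e $ 0 * w $ 0 * lform e w < 0" "(M *v e) $ 0 * w $ 0 * lform (M *v e) w < 0"
    using lform_time_sign[of e w] lform_time_sign[of "M *v e" w] e Me assms(2,3)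
    by (auto simp: hyp_pt_def)
  moreover have "e $ 0 > 0" "(M *v e) $ 0 > 0" using e Me by (auto simp: hyp_pt_def)
  ultimately show False by (smt (verit) mult_less_0_iff mult_pos_pos mult_neg_neg mult.assoc mult_minus_right)
qed

text \<open>For eigenvalue 1, w is orthogonal to a non-spacelike vector of the span of a and b,
  hence parallel to it. Otherwise the component of w in the rotation plane is an eigenvector of a
  rotation of a definite plane; since k is neither 1 nor -1, it is zero.\<close>

lemma rquad_eigenvector:
  assumes r: "rquad a b c d" and ab: "(lform a b)\<^sup>2 \<ge> 1"
    and w: "lform w w = 0" "w \<noteq> 0" "((refl a ** refl b) ** (refl d ** refl c)) *v w = k *\<^sub>R w"
  shows "w \<in> span {a, b}"
proof (cases "k = 1")
  case True
  note u = upair_nonspacelike[OF rquadD(2)[OF r] ab]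
  have "w \<in> lorth {a, b}" using rquad_fixed[OF r] w(3) True by simp
  then have "lform (a - lform a b *\<^sub>R b) w = 0" by (simp add: in_lorth lform_bilin lform_sym[of _ w])
  then obtain s where "w = s *\<^sub>R (a - lform a b *\<^sub>R b)"
    using orthogonal_nonspacelike_parallel[OF u(1,3), of w] w(1) by auto
  then show ?thesis using u(4) by (simp add: span_scale)
next
  case False
  note q = rquadD(1)[OF r]
  note D = quadD[OF q]
  define T where "T = refl a ** refl b"
  define R where "R = refl d ** refl c"
  have opi: "opi (T ** R)" unfolding T_def R_def using D by (intro opi_mult opi_refl_refl) auto
  \<comment> \<open>The displacement of w is \<open>(k - 1) *\<^sub>R w\<close> and is the sum of
    the displacements by T and R; dividing by \<open>k - 1\<close> splits w along the two
    spans.\<close>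
  define p where "p = (1 / (k - 1)) *\<^sub>R (T *v w - w)"
  define q' where "q' = (1 / (k - 1)) *\<^sub>R (R *v w - w)"
  have p: "p \<in> span {a, b}" and q'_span: "q' \<in> span {d, c}"
    unfolding p_def q'_def T_def R_def by (intro span_scale refl_refl_diff_span D)+
  have "(T *v w - w) + (R *v w - w) = (k - 1) *\<^sub>R w"
    using w(3) quad_mv[OF q, of w] by (simp add: T_def R_def algebra_simps)
  then have "p + q' = (1 / (k - 1)) *\<^sub>R ((k - 1) *\<^sub>R w)"
    unfolding p_def q'_def by (simp only: flip: scaleR_add_right)
  then have wpq: "w = p + q'" using False by simp
  have "lform p c = 0" "lform p d = 0" "lform q' a = 0" "lform q' b = 0"
    using p q'_span by (auto simp: span_pair lform_bilin D)
  then have Rp: "R *v p = p" and Tq: "T *v q' = q'"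
    unfolding R_def T_def refl_refl_mv[OF D(1,2)] refl_refl_mv[OF D(4,3)] by simp_all
  have "(T ** R) *v w = T *v p + R *v q'"
  proof -
    have "(T ** R) *v p = T *v p" "(T ** R) *v q' = R *v q'"
      using quad_mv[OF q, of q'] Rp Tq by (simp_all add: T_def R_def flip: matrix_vector_mul_assoc)
    then show ?thesis by (simp add: wpq matrix_vector_right_distrib)
  qed
  then have "T *v p + R *v q' = k *\<^sub>R p + k *\<^sub>R q'"
    using w(3) by (simp add: T_def R_def wpq scaleR_add_right)
  then have "T *v p - k *\<^sub>R p = k *\<^sub>R q' - R *v q'" by (simp add: algebra_simps)
  moreover have "T *v p - k *\<^sub>R p \<in> span {a, b}"
  proof -
    have "T *v p = (T *v p - p) + p" by simp
    also have "\<dots> \<in> span {a, b}" unfolding T_def by (intro span_add refl_refl_diff_span D p)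
    finally show ?thesis by (intro span_diff span_scale p)
  qed
  moreover have "k *\<^sub>R q' - R *v q' \<in> span {d, c}"
  proof -
    have "R *v q' = (R *v q' - q') + q'" by simp
    also have "\<dots> \<in> span {d, c}" unfolding R_def by (intro span_add refl_refl_diff_span D q'_span)
    finally show ?thesis by (intro span_diff span_scale q'_span)
  qed
  ultimately have Rq: "R *v q' = k *\<^sub>R q'" using rquad_span_Int[OF r] by fastforce
  have "liso R" unfolding R_def using D by (intro liso_mult refl_liso) auto
  then have "lform q' q' = k * k * lform q' q'"
    using lisoD[of R q' q'] unfolding Rq by (simp add: lform_bilin)
  moreover have "k * k \<noteq> 1"
    using False opi_eigenvalue_minus_one[OF opi, of w] w by (auto simp: square_eq_1_iff T_def R_def)
  ultimately have "lform q' q' = 0" by (simp add: algebra_simps)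
  then have "q' = 0" using rquad_positive[OF r q'_span] by force
  then show ?thesis using wpq p by simp
qed

lemma rquad_no_fixpts:
  assumes r: "rquad a b c d" and ab: "(lform a b)\<^sup>2 \<ge> 1"
  shows "fixpts ((refl a ** refl b) ** (refl d ** refl c)) = {}"
proof -
  note u = upair_nonspacelike[OF rquadD(2)[OF r] ab]
  have False if "hyp_pt x" "x \<in> lorth {a, b}" for x
  proof -
    have "lform x (a - lform a b *\<^sub>R b) = 0" using that(2) by (simp add: in_lorth lform_bilin)
    then show False
      using orthogonal_timelike_spacelike[of x "a - lform a b *\<^sub>R b"] u(1,3) that(1)
      by (auto simp: hyp_pt_def)
  qed
  then show ?thesis using rquad_fixed[OF r] by (auto simp: fixpts_def)
qed

text \<open>The quadratic says that x a + b is null; the eigenvalue is x squared.\<close>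
lemma rquad_fixray:
  assumes r: "rquad a b c d" and x: "x * x + 2 * lform a b * x + 1 = 0"
  shows "fixray ((refl a ** refl b) ** (refl d ** refl c)) (x *\<^sub>R a + b)"
proof -
  note q = rquadD(1)[OF r]
  note D = quadD[OF q]
  define k where "k = lform a b"
  have k: "lform a b = k" "lform b a = k" by (simp_all add: k_def lform_sym)
  let ?u = "x *\<^sub>R a + b"
  have va: "lform ?u a = x + k" "lform ?u b = x * k + 1" by (simp_all add: lform_bilin D k)
  have "(refl a ** refl b) *v ?u = (x - (2 * (x + k) - 4 * k * (x * k + 1))) *\<^sub>R a + (1 - 2 * (x * k + 1)) *\<^sub>R b"
    unfolding refl_refl_mv[OF D(1,2)] va k scaleR_diff_left[of x] scaleR_diff_left[of 1] scaleR_one by simp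
  also have "x - (2 * (x + k) - 4 * k * (x * k + 1)) = x * x * x" using x k by algebra
  also have "1 - 2 * (x * k + 1) = x * x" using x k by algebra
  finally have T: "(refl a ** refl b) *v ?u = (x * x) *\<^sub>R ?u" by (simp add: scaleR_add_right)
  have "(refl d ** refl c) *v ?u = ?u" by (simp add: refl_refl_mv[OF D(4,3)] lform_bilin D)
  then have "((refl a ** refl b) ** (refl d ** refl c)) *v ?u = (x * x) *\<^sub>R ?u"
    using quad_mv[OF q, of ?u] T by simp
  moreover have "lform ?u ?u = 0" using x by (simp add: lform_bilin D k algebra_simps)
  moreover have "?u \<noteq> 0"
    using upair_coeffs(2)[OF rquadD(2)[OF r], of x "-1"] by (auto simp: add_eq_0_iff)
  ultimately show ?thesis by (auto simp: fixray_def)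
qed

lemma rquad_fixray_cases:
  assumes r: "rquad a b c d" and ab: "(lform a b)\<^sup>2 \<ge> 1"
    and w: "fixray ((refl a ** refl b) ** (refl d ** refl c)) w"
  obtains x where "x * x + 2 * lform a b * x + 1 = 0" "w \<in> span {x *\<^sub>R a + b}"
proof -
  note D = quadD[OF rquadD(1)[OF r]]
  define k where "k = lform a b"
  have k: "lform a b = k" "lform b a = k" by (simp_all add: k_def lform_sym)
  have ww: "w \<noteq> 0" "lform w w = 0" using w by (auto simp: fixray_def)
  have "w \<in> span {a, b}" using rquad_eigenvector[OF r ab] w by (auto simp: fixray_def)
  then obtain s t where st: "w = s *\<^sub>R a + t *\<^sub>R b" by (auto simp: span_pair)
  have n: "s * s + 2 * k * s * t + t * t = 0" using ww(2) by (simp add: st lform_bilin D k algebra_simps)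
  have t: "t \<noteq> 0" using n ww(1) st by auto
  have "(s / t) * (s / t) + 2 * k * (s / t) + 1 = (s * s + 2 * k * s * t + t * t) / (t * t)"
    using t by (simp add: field_simps)
  then have "(s / t) * (s / t) + 2 * k * (s / t) + 1 = 0" using n by simp
  moreover have "w = t *\<^sub>R ((s / t) *\<^sub>R a + b)" using t by (simp add: st scaleR_add_right)
  then have "w \<in> span {(s / t) *\<^sub>R a + b}" by (auto simp: span_singleton)
  ultimately show thesis using that unfolding k by blast
qed

lemma rquad_opi: "rquad a b c d \<Longrightarrow> opi ((refl a ** refl b) ** (refl d ** refl c))"
  using quadD[OF rquadD(1)] by (intro opi_mult opi_refl_refl) auto

text \<open>The quadratic of \<open>rquad_fixray\<close> has discriminant
  \<open>4 * (k * k - 1)\<close>. Here it vanishes, and the double root gives the only invariant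
  null direction.\<close>

lemma rquad_parabolic:
  assumes r: "rquad a b c d" and ab: "(lform a b)\<^sup>2 = 1"
  shows "screw_par ((refl a ** refl b) ** (refl d ** refl c))"
proof -
  define k where "k = lform a b"
  have k: "k * k = 1" using ab by (simp add: k_def power2_eq_square)
  have root: "x = - k" if "x * x + 2 * k * x + 1 = 0" for x
  proof -
    have "(x + k) * (x + k) = 0" using that k by algebra
    then show ?thesis by (simp add: add_eq_0_iff)
  qed
  let ?u = "(- k) *\<^sub>R a + b"
  have "fixray ((refl a ** refl b) ** (refl d ** refl c)) ?u"
    using k by (intro rquad_fixray[OF r]) (simp flip: k_def)
  moreover have "w \<in> span {?u}" if "fixray ((refl a ** refl b) ** (refl d ** refl c)) w" for w
    using rquad_fixray_cases[OF r _ that] ab root unfolding k_def by (metis order_refl)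
  ultimately show ?thesis
    using rquad_no_fixpts[OF r] rquad_opi[OF r] rquad_not_pure[OF r] ab
    unfolding screw_par_def parabolic_def by (metis order_refl)
qed

text \<open>Now the discriminant is positive, and the two roots give the two ends of the
  axis.\<close>

lemma rquad_loxodromic:
  assumes r: "rquad a b c d" and ab: "(lform a b)\<^sup>2 > 1"
  shows "pure_lox ((refl a ** refl b) ** (refl d ** refl c))"
proof -
  let ?M = "(refl a ** refl b) ** (refl d ** refl c)"
  define k where "k = lform a b"
  define s where "s = sqrt (k * k - 1)"
  have s: "s * s = k * k - 1" "s > 0" using ab by (simp_all add: s_def k_def power2_eq_square)
  have root: "x = s - k \<or> x = - s - k" if "x * x + 2 * k * x + 1 = 0" for x
  proof -
    have "(x + k - s) * (x + k + s) = 0" using that s by algebra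
    then show ?thesis by auto
  qed
  let ?u = "(s - k) *\<^sub>R a + b" and ?v = "(- s - k) *\<^sub>R a + b"
  have "(s - k) * (s - k) + 2 * k * (s - k) + 1 = 0" "(- s - k) * (- s - k) + 2 * k * (- s - k) + 1 = 0"
    using s by algebra+
  then have "fixray ?M ?u" "fixray ?M ?v" by (auto intro: rquad_fixray[OF r] simp: k_def)
  moreover have "w \<in> span {?u} \<or> w \<in> span {?v}" if "fixray ?M w" for w
    using rquad_fixray_cases[OF r _ that] ab root unfolding k_def by (metis less_imp_le)
  moreover have "?v \<notin> span {?u}"
  proof
    assume "?v \<in> span {?u}"
    then obtain t where "?v = t *\<^sub>R ?u" by (auto simp: span_singleton)
    then have e: "((- s - k) - t * (s - k)) *\<^sub>R a = (t - 1) *\<^sub>R b" by (simp add: algebra_simps)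
    have "t = 1" "(- s - k) - t * (s - k) = 0" using upair_coeffs[OF rquadD(2)[OF r] e] by auto
    then show False using s by simp
  qed
  moreover have "fixpts ?M = {}" using rquad_no_fixpts[OF r] ab by simp
  ultimately have "loxodromic ?M" unfolding loxodromic_def using rquad_opi[OF r] by blast
  then show ?thesis using rquad_not_pure[OF r] by (simp add: pure_lox_def)
qed

text \<open>The plane is the fixed space of the rotation, with which the whole product
  commutes.\<close>

lemma rquad_img:
  assumes r: "rquad a b c d"
  shows "img ((refl a ** refl b) ** (refl d ** refl c)) (lorth {d, c}) = lorth {d, c}"
proof -
  note D = quadD[OF rquadD(1)[OF r]]
  let ?T = "refl a ** refl b" and ?R = "refl d ** refl c"
  have R: "?R *v v = v \<longleftrightarrow> v \<in> lorth {d, c}" for v by (rule refl_refl_fixed[OF rquadD(3)[OF r]])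
  have l: "liso (?T ** ?R)" using rquad_opi[OF r] by (rule opi_liso)
  have comm: "(?T ** ?R) *v (?R *v v) = ?R *v ((?T ** ?R) *v v)" for v
    using quad_commute[OF rquadD(1)[OF r]] by (metis matrix_vector_mul_assoc)
  show ?thesis
  proof safe
    fix x assume "x \<in> img (?T ** ?R) (lorth {d, c})"
    then obtain y where "x = (?T ** ?R) *v y" "y \<in> lorth {d, c}" by (auto simp: img_def)
    then show "x \<in> lorth {d, c}" using comm[of y] R by metis
  next
    fix x assume x: "x \<in> lorth {d, c}"
    define y where "y = matrix_inv (?T ** ?R) *v x"
    have y: "(?T ** ?R) *v y = x" by (simp add: y_def liso_inverse_mv(1)[OF l])
    have "(?T ** ?R) *v (?R *v y) = (?T ** ?R) *v y" using comm[of y] y x R by simp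
    then have "?R *v y = y" by (metis liso_inverse_mv(2)[OF l])
    then have "y \<in> lorth {d, c}" using R by simp
    then show "x \<in> img (?T ** ?R) (lorth {d, c})" using y by (auto simp: img_def)
  qed
qed

text \<open>Both spans are definite and mutually orthogonal, so they carry four orthonormal
  spacelike normals; the projection of the time axis spans the remaining line and is
  timelike.\<close>

lemma rquad_axis_point:
  assumes r: "rquad a b c d" and ab: "(lform a b)\<^sup>2 < 1"
  obtains x where "hyp_pt x" "lorth {a, b} \<inter> lorth {d, c} = span {x}"
proof -
  note q = rquadD(1)[OF r]
  note D = quadD[OF q]
  obtain n where n: "onpair b n" "span {a, b} = span {b, n}" "lorth {a, b} = lorth {b, n}"
    using definite_pair_orthonormal[OF D(1,2) ab] .
  obtain m where m: "onpair c m" "span {d, c} = span {c, m}" "lorth {d, c} = lorth {c, m}"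
    using definite_pair_orthonormal[OF D(4,3) rquadD(4)[OF r]] .
  note N = onpairD[OF n(1)] and Mm = onpairD[OF m(1)]
  have o: "lform p s = 0" "lform s p = 0" if "p \<in> {b, n}" "s \<in> {c, m}" for p s
    using quad_span_orthogonal[OF q, of p s] n(2) m(2) that span_base[of p "{b, n}"] span_base[of s "{c, m}"]
    by (auto simp: lform_sym[of s p])
  have "n \<notin> span {c, m}" by (rule lorth_not_in_span) (use N o in \<open>auto simp: in_lorth\<close>)
  then have "dim {n, c, m} = 3" using onpair_independent(3)[OF m(1)] by (simp add: dim_insert)
  moreover have "b \<notin> span {n, c, m}" by (rule lorth_not_in_span) (use N o in \<open>auto simp: in_lorth\<close>)
  ultimately have "dim {b, n, c, m} = 4" by (simp add: dim_insert)
  define Q where "Q = lorth {b, n, c, m}"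
  have dQ: "dim Q = 1" using dim_lorth[of "{b, n, c, m}"] \<open>dim {b, n, c, m} = 4\<close> by (simp add: Q_def)
  define e :: vec5 where "e = axis 0 1"
  have e: "lform e e = -1" by (simp add: e_def lform_axis_axis)
  define v where "v = e - lform e b *\<^sub>R b - lform e n *\<^sub>R n - lform e c *\<^sub>R c - lform e m *\<^sub>R m"
  have vQ: "v \<in> Q" by (simp add: v_def Q_def in_lorth lform_bilin N Mm o)
  have "lform v v = lform v e"
    using vQ by (subst (2) v_def) (simp add: Q_def in_lorth lform_bilin)
  also have "\<dots> = -1 - (lform e b)\<^sup>2 - (lform e n)\<^sup>2 - (lform e c)\<^sup>2 - (lform e m)\<^sup>2"
    by (simp add: v_def lform_bilin e lform_sym[of b e] lform_sym[of n e] lform_sym[of c e] lform_sym[of m e]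
        power2_eq_square)
  finally have "lform v v < 0" by (smt (verit) zero_le_power2)
  then obtain t where t: "t \<noteq> 0" "hyp_pt (t *\<^sub>R v)" by (rule normalize_timelike)
  define x where "x = t *\<^sub>R v"
  have x: "hyp_pt x" using t by (simp add: x_def)
  have "x \<noteq> 0" using x by (auto simp: hyp_pt_def lform_bilin)
  have "x \<in> Q" using vQ by (simp add: x_def Q_def subspace_scale subspace_lorth)
  then have "span {x} \<subseteq> Q" by (intro span_minimal) (auto simp: Q_def subspace_lorth)
  moreover have "dim (span {x}) = 1" using \<open>x \<noteq> 0\<close> by (simp add: dim_singleton)
  ultimately have "span {x} = Q"
    using dQ by (intro subspace_dim_equal) (auto simp: Q_def subspace_lorth)
  moreover have "lorth {a, b} \<inter> lorth {d, c} = Q" by (auto simp: n(3) m(3) Q_def in_lorth)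
  ultimately show thesis using that x by simp
qed

text \<open>Removing from v its components along the normals of the second plane leaves a vector of
  both planes, a multiple of x that is also orthogonal to x. So v is itself a normal of the second
  plane.\<close>

lemma rquad_orth_at:
  assumes r: "rquad a b c d" and x: "hyp_pt x" "lorth {a, b} \<inter> lorth {d, c} = span {x}"
  shows "orth_at (lorth {a, b}) (lorth {d, c}) x"
  unfolding orth_at_def
proof (intro conjI ballI x(2))
  note D = quadD[OF rquadD(1)[OF r]]
  fix v w assume v: "v \<in> lorth {a, b} \<inter> lorth {x}" and w: "w \<in> lorth {d, c} \<inter> lorth {x}"
  obtain m where m: "onpair c m" "span {d, c} = span {c, m}" "lorth {d, c} = lorth {c, m}"
    using definite_pair_orthonormal[OF D(4,3) rquadD(4)[OF r]] .
  note Mm = onpairD[OF m(1)]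
  have xx: "x \<in> lorth {a, b}" "x \<in> lorth {c, m}" using x(2) m(3) span_base[of x "{x}"] by auto
  have "m \<in> span {d, c}" using m(2) by (simp add: span_base)
  then have mab: "m \<in> lorth {a, b}" by (auto simp: span_pair in_lorth lform_bilin D)
  define v' where "v' = v - lform v c *\<^sub>R c - lform v m *\<^sub>R m"
  have "v' \<in> lorth {a, b}" using v mab by (simp add: v'_def in_lorth lform_bilin D)
  moreover have "v' \<in> lorth {d, c}" unfolding m(3) v'_def by (rule onpair_projection[OF m(1)])
  ultimately obtain t where t: "v' = t *\<^sub>R x" using x(2) by (auto simp: span_singleton)
  have "lform v' x = 0" using v xx(2) by (simp add: v'_def in_lorth lform_bilin lform_sym[of c x] lform_sym[of m x])
  then have "t = 0" using x(1) unfolding t by (simp add: lform_bilin hyp_pt_def)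
  then have "v = lform v c *\<^sub>R c + lform v m *\<^sub>R m" using t by (simp add: v'_def algebra_simps)
  moreover have "lform c w = 0" "lform m w = 0" using w m(3) by (auto simp: in_lorth lform_sym[of _ w])
  ultimately show "lform v w = 0" by (metis lform_add_left lform_scaleR_left mult_zero_right add_0)
qed

lemma rquad_ell2:
  assumes r: "rquad a b c d" and x: "hyp_pt x" "lorth {a, b} \<inter> lorth {d, c} = span {x}"
  shows "ell2 ((refl a ** refl b) ** (refl d ** refl c)) x"
proof -
  have "y = x" if y: "hyp_pt y" "y \<in> span {x}" for y
  proof -
    obtain t where t: "y = t *\<^sub>R x" using y(2) by (auto simp: span_singleton)
    have "t * t = 1" using x(1) y(1) unfolding t hyp_pt_def by (simp add: lform_bilin)
    moreover have "t > 0" using x(1) y(1) unfolding t hyp_pt_def by (simp add: zero_less_mult_iff)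
    ultimately have "t = 1" by (auto simp: square_eq_1_iff)
    then show ?thesis using t by simp
  qed
  moreover have "((refl a ** refl b) ** (refl d ** refl c)) *v v = v \<longleftrightarrow> v \<in> span {x}" for v
    using rquad_fixed[OF r] x(2) by blast
  ultimately show ?thesis
    using rquad_opi[OF r] x(1) by (auto simp: ell2_def fixpts_def span_base)
qed

lemma half_factor_Kbank: assumes "half_factor M W" shows "W \<in> Kbank M"
proof -
  have W: "plane W" using assms by (simp add: half_factor_def)
  obtain a b c d where q: "quad a b c d" and Wbc: "W = lorth {b, c}"
    and M: "M = (refl a ** refl b) ** (refl d ** refl c)"
    and cases: "c = d \<or> upair a b \<and> upair c d \<and> (lform c d)\<^sup>2 < 1"
    using half_factor_normal_form[OF assms] .
  note D = quadD[OF q]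
  have Wst: "W = lorth {b} \<inter> lorth {c}" by (simp add: Wbc lorth_Int insert_commute)
  show ?thesis
  proof (cases "c = d")
    case True
    then have M': "M = refl a ** refl b" using M D(4) by (simp add: refl_involution)
    show ?thesis
    proof (cases "M = mat 1")
      case True
      then show ?thesis using W by (simp add: Kbank_def)
    next
      case False
      then have up: "upair a b" using upair_if_not_id[OF D(1,2)] M' by simp
      have "c \<in> lorth {a, b}" by (simp add: in_lorth D)
      then have "lorth {c} \<in> Tset M" "lorth {b} \<in> Fset M" "atomic M"
        using Tset_refl_refl[OF up D(3)] Fset_refl_refl[OF up] atomic_refl_refl[OF up] M' by simp_all
      then show ?thesis unfolding Kbank_def using Wst by blast
    qed
  next
    case False
    then have r: "rquad a b c d" using cases q by (simp add: rquad_def)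
    let ?T = "refl a ** refl b" and ?R = "refl d ** refl c" and ?P = "lorth {d, c}"
    have R: "ell1 ?R ?P" by (rule rquad_ell1[OF r])
    have F: "lorth {b} \<in> Fset ?T" by (rule Fset_refl_refl[OF rquadD(2)[OF r]])
    have comm: "?T ** ?R = ?R ** ?T" by (rule quad_commute[OF q])
    have hp: "hyperplane (lorth {c})" using D(3) by (auto simp: hyperplane_iff)
    have Pt: "?P \<subseteq> lorth {c}" by (auto simp: in_lorth)
    have screw: "W \<in> Kbank M" if "(pure_lox M \<and> pure_hyp ?T) \<or> (screw_par M \<and> pure_par ?T)"
    proof -
      have "img M ?P = ?P" using rquad_img[OF r] M by simp
      then show ?thesis unfolding Kbank_def using M comm that R F hp Pt Wst by blast
    qed
    consider "(lform a b)\<^sup>2 > 1" | "(lform a b)\<^sup>2 = 1" | "(lform a b)\<^sup>2 < 1" by linarith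
    then show ?thesis
    proof cases
      case 1
      then show ?thesis
        using screw rquad_loxodromic[OF r 1] pure_hyp_refl_refl[OF rquadD(2)[OF r] 1] M by simp
    next
      case 2
      then show ?thesis
        using screw rquad_parabolic[OF r 2] pure_par_refl_refl[OF rquadD(2)[OF r] 2] M by simp
    next
      case 3
      obtain x where x: "hyp_pt x" "lorth {a, b} \<inter> lorth {d, c} = span {x}"
        using rquad_axis_point[OF r 3] .
      have e2: "ell2 M x" using rquad_ell2[OF r x] M by simp
      show ?thesis
      \<comment> \<open>For an involution the bank consists of all planes through x, and x is
        orthogonal to b and c; otherwise the two rotations serve as the decomposition.\<close>
      proof (cases "M ** M = mat 1")
        case True
        have "x \<in> lorth {a, b} \<inter> lorth {d, c}" using x(2) by (simp add: span_base)
        then have "x \<in> W" by (simp add: Wbc in_lorth)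
        then show ?thesis unfolding Kbank_def using e2 True W by blast
      next
        case False
        have "ell1 ?T (lorth {a, b})" by (rule ell1_refl_refl[OF rquadD(2)[OF r] 3])
        moreover have "lorth {c} \<in> Fset ?R" by (rule Fset_refl_refl[OF rquadD(3)[OF r]])
        moreover note rquad_orth_at[OF r x]
        ultimately show ?thesis
          unfolding Kbank_def using M comm R F Wst e2 False by blast
      qed
    qed
  qed
qed

section \<open>Linked pairs and common half-turn factors\<close>

lemma half_turn_conj:
  assumes "plane \<beta>" "plane \<delta>"
  obtains \<epsilon> where "plane \<epsilon>" "half_turn \<beta> ** half_turn \<delta> = half_turn \<epsilon> ** half_turn \<beta>"
proof -
  obtain a b where ab: "onpair a b" "\<beta> = lorth {a, b}" using assms by (auto simp: plane_iff)
  obtain c d where cd: "onpair c d" "\<delta> = lorth {c, d}" using assms by (auto simp: plane_iff)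
  define H where "H = refl a ** refl b"
  have l: "liso H" unfolding H_def using onpairD[OF ab(1)] by (intro liso_mult refl_liso) auto
  have on: "onpair (H *v c) (H *v d)" using cd(1) by (simp add: onpair_def lisoD[OF l])
  have "half_turn (lorth {H *v c, H *v d}) = H ** (refl c ** refl d) ** matrix_inv H"
    using half_turn_onpair[OF on] refl_refl_conj[OF l] by simp
  then have "half_turn (lorth {H *v c, H *v d}) ** H = H ** (refl c ** refl d)"
    by (simp add: liso_inverse[OF l] flip: matrix_mul_assoc)
  then show thesis
    using that[of "lorth {H *v c, H *v d}"] onpair_plane[OF on] half_turn_onpair[OF ab(1)]
      half_turn_onpair[OF cd(1)] ab(2) cd(2) by (simp add: H_def)
qed

lemma half_turn_involution: assumes "plane \<beta>" shows "half_turn \<beta> ** half_turn \<beta> = mat 1"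
proof -
  obtain a b where ab: "onpair a b" "\<beta> = lorth {a, b}" using assms by (auto simp: plane_iff)
  note D = onpairD[OF ab(1)]
  have "refl b *v (refl a *v v) = refl a *v (refl b *v v)" for v
    using refl_commute[OF D(4)] by (metis matrix_vector_mul_assoc)
  then show ?thesis
    by (simp add: ab(2) half_turn_onpair[OF ab(1)] matrix_eq refl_involution_mv D flip: matrix_vector_mul_assoc)
qed

text \<open>Here \<epsilon> is given and \<delta> sought. Applying \<open>half_turn_conj\<close> to
  \<epsilon> and multiplying by the half-turn about \<beta> on both sides suffices, since that
  half-turn is an involution.\<close>

lemma half_turn_conj':
  assumes "plane \<beta>" "plane \<epsilon>"
  obtains \<delta> where "plane \<delta>" "half_turn \<beta> ** half_turn \<delta> = half_turn \<epsilon> ** half_turn \<beta>"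
proof -
  obtain \<delta> where d: "plane \<delta>" "half_turn \<beta> ** half_turn \<epsilon> = half_turn \<delta> ** half_turn \<beta>"
    using half_turn_conj[OF assms] .
  have "half_turn \<beta> ** (half_turn \<beta> ** half_turn \<epsilon>) ** half_turn \<beta>
      = half_turn \<beta> ** half_turn \<delta> ** (half_turn \<beta> ** half_turn \<beta>)"
    by (simp only: d(2) matrix_mul_assoc)
  then have "half_turn \<epsilon> ** half_turn \<beta> = half_turn \<beta> ** half_turn \<delta>"
    by (simp add: half_turn_involution[OF assms(1)] matrix_mul_assoc)
  then show thesis using that d(1) by simp
qed

lemma linked_iff: "linked A B \<longleftrightarrow> (\<exists>\<beta>. half_factor A \<beta> \<and> half_factor B \<beta>)"
proof
  assume "linked A B"
  then obtain \<alpha> \<beta> \<delta> where h: "plane \<alpha>" "plane \<beta>" "plane \<delta>"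
    "A = half_turn \<alpha> ** half_turn \<beta>" "B = half_turn \<beta> ** half_turn \<delta>" by (auto simp: linked_def)
  then show "\<exists>\<beta>. half_factor A \<beta> \<and> half_factor B \<beta>"
    using half_turn_conj[OF h(2,3)] unfolding half_factor_def by metis
next
  assume "\<exists>\<beta>. half_factor A \<beta> \<and> half_factor B \<beta>"
  then obtain \<alpha> \<beta> \<epsilon> where h: "plane \<alpha>" "plane \<beta>" "plane \<epsilon>"
    "A = half_turn \<alpha> ** half_turn \<beta>" "B = half_turn \<epsilon> ** half_turn \<beta>" by (auto simp: half_factor_def)
  then show "linked A B" using half_turn_conj'[OF h(2,3)] unfolding linked_def by metis
qed

theorem theorem1p1:
  assumes "opi A" and "opi B"
  shows "linked A B \<longleftrightarrow> Kbank A \<inter> Kbank B \<noteq> {}"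
  using linked_iff Kbank_half_factor half_factor_Kbank by blast

end
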